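(* Let $G=(V,E)$ be a rooted tree of depth $L$. Then one can efficiently construct a rooted tree $G'=(V',E')$ with $|V'|\le|V|$ and depth $L'=O(\log L)$ such that: (i) if the RMFC problem on $G$ has a solution with budget $B\in\mathbb{Z}_{>0}$ at each level, then the RMFC problem on $G'$ with non-uniform budgets, where level $\ell\ge1$ has budget $B_\ell=2^\ell\cdot B$, has a solution; and (ii) any solution to the RMFC problem on $G'$ where level $\ell$ has budget $B_\ell=2^\ell\cdot B$ can be transformed efficiently into an RMFC solution for $G$ with budget $2B$.
   Context: RMFC on a rooted tree $G$ (root $r$, depth $L$, leaves $\Gamma$): the fire starts at $r$ at time $0$ and spreads one level per time step to adjacent unprotected vertices. With budgets $B_\ell$ for levels/time steps $\ell\in[L]$, a solution is a set $S\subseteq V\setminus\{r\}$ of vertices to protect with $|S\cap V_{\le\ell}|\le\sum_{i=1}^\ell B_i$ for all $\ell$ (where $V_{\le\ell}$ is the set of vertices at distance between $1$ and $\ell$ from $r$) such that every root-leaf path contains a vertex of $S$, i.e., no leaf catches fire. "Budget $B$ at each level" means $B_\ell=B$ for all $\ell$. *)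

theory Defs
  imports
    Complex_Main
    "HOL-Library.Landau_Symbols"
    "HOL-Computational_Algebra.Polynomial"
    "Graph_Theory.Graph_Theory"
begin

section \<open>Rooted trees\<close>

text \<open>
  As usual in \<^theory>\<open>Graph_Theory.Graph_Theory\<close>, a finite simple undirected graph is a symmetric
  loop-free digraph \<^const>\<open>pair_graph\<close>. An undirected edge traversed back and forth is a closed
  walk of length 2 there, which is why only cycles of length at least 3 are excluded (and why
  the library's notion of a tree, which is meant for directed graphs, does not apply).
\<close>

definition rooted_tree :: "'a pair_pre_digraph \<Rightarrow> 'a \<Rightarrow> bool" where
  "rooted_tree G r \<longleftrightarrow>
     pair_graph G \<and> r \<in> pverts G \<and>
     Digraph_Component.connected (with_proj G) \<and>
     \<not> (\<exists>p. pre_digraph.cycle (with_proj G) p \<and> length p \<ge> 3)"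

definition level :: "'a pair_pre_digraph \<Rightarrow> 'a \<Rightarrow> 'a \<Rightarrow> nat" where
  "level G r v = (LEAST n. \<exists>p. pre_digraph.awalk (with_proj G) r p v \<and> length p = n)"

definition depth :: "'a pair_pre_digraph \<Rightarrow> 'a \<Rightarrow> nat" where
  "depth G r = Max (level G r ` pverts G)"

text \<open>Leaves are the vertices without children; the root of a one-vertex tree is a leaf.\<close>

definition leaves :: "'a pair_pre_digraph \<Rightarrow> 'a \<Rightarrow> 'a set" where
  "leaves G r = {v \<in> pverts G. \<not> (\<exists>w. (v, w) \<in> parcs G \<and> level G r w > level G r v)}"

section \<open>The RMFC problem\<close>

definition rmfc_solution :: "'a pair_pre_digraph \<Rightarrow> 'a \<Rightarrow> (nat \<Rightarrow> nat) \<Rightarrow> 'a set \<Rightarrow> bool" where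
  "rmfc_solution G r B S \<longleftrightarrow>
     S \<subseteq> pverts G - {r} \<and>
     (\<forall>l\<in>{1..depth G r}.
        card (S \<inter> {v \<in> pverts G. 1 \<le> level G r v \<and> level G r v \<le> l}) \<le> (\<Sum>i=1..l. B i)) \<and>
     (\<forall>p. vpath p (with_proj G) \<and> hd p = r \<and> last p \<in> leaves G r \<longrightarrow> set p \<inter> S \<noteq> {})"

section \<open>Polynomial-time computability\<close>

text \<open>
  The machine model is the language WHILE over binary trees (Jones, Computability and Complexity
  from a Programming Perspective). Variables are numbered and hold values of type \<open>sexp\<close>; as in
  Jones' book, destructors applied to the atom return the atom, and the atom stands for falsity.
  Evaluating an expression is charged one plus the size of the value for each of its
  subexpressions. The memory in use is therefore bounded by the input plus the time spent, and
  running times are polynomially related to those of Turing machines. (The generated function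
  \<^const>\<open>size\<close> on \<open>sexp\<close> counts the cells.)
\<close>

datatype sexp = Atom | Cell sexp sexp

fun car :: "sexp \<Rightarrow> sexp" where
  "car Atom = Atom"
| "car (Cell a b) = a"

fun cdr :: "sexp \<Rightarrow> sexp" where
  "cdr Atom = Atom"
| "cdr (Cell a b) = b"

type_synonym state = "nat \<Rightarrow> sexp"

datatype expr = AtomE | Var nat | Cons expr expr | Car expr | Cdr expr | Equal expr expr

primrec eval_expr :: "expr \<Rightarrow> state \<Rightarrow> sexp" where
  "eval_expr AtomE s = Atom"
| "eval_expr (Var x) s = s x"
| "eval_expr (Cons e f) s = Cell (eval_expr e s) (eval_expr f s)"
| "eval_expr (Car e) s = car (eval_expr e s)"
| "eval_expr (Cdr e) s = cdr (eval_expr e s)"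
| "eval_expr (Equal e f) s = (if eval_expr e s = eval_expr f s then Cell Atom Atom else Atom)"

primrec cost :: "expr \<Rightarrow> state \<Rightarrow> nat" where
  "cost AtomE s = 1"
| "cost (Var x) s = 1 + size (s x)"
| "cost (Cons e f) s = cost e s + cost f s + 1 + size (eval_expr (Cons e f) s)"
| "cost (Car e) s = cost e s + 1 + size (eval_expr (Car e) s)"
| "cost (Cdr e) s = cost e s + 1 + size (eval_expr (Cdr e) s)"
| "cost (Equal e f) s = cost e s + cost f s + 1 + size (eval_expr (Equal e f) s)"

datatype com = Skip | Assign nat expr | Seq com com | Cond expr com com | While expr com

text \<open>\<open>exec c s t s'\<close>: started in state \<open>s\<close>, program \<open>c\<close> halts in state \<open>s'\<close> after time \<open>t\<close>.\<close>

inductive exec :: "com \<Rightarrow> state \<Rightarrow> nat \<Rightarrow> state \<Rightarrow> bool" where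
  Skip: "exec Skip s 1 s"
| Assign: "exec (Assign x e) s (1 + cost e s) (s(x := eval_expr e s))"
| Seq: "exec c s t s' \<Longrightarrow> exec d s' t' s'' \<Longrightarrow> exec (Seq c d) s (1 + t + t') s''"
| CondTrue: "eval_expr e s \<noteq> Atom \<Longrightarrow> exec c s t s' \<Longrightarrow>
    exec (Cond e c d) s (1 + cost e s + t) s'"
| CondFalse: "eval_expr e s = Atom \<Longrightarrow> exec d s t s' \<Longrightarrow>
    exec (Cond e c d) s (1 + cost e s + t) s'"
| WhileFalse: "eval_expr e s = Atom \<Longrightarrow> exec (While e c) s (1 + cost e s) s"
| WhileTrue: "eval_expr e s \<noteq> Atom \<Longrightarrow> exec c s t s' \<Longrightarrow> exec (While e c) s' t' s'' \<Longrightarrow>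
    exec (While e c) s (1 + cost e s + t + t') s''"

text \<open>
  \<open>polytime_on enc enc' X f\<close>: some program computes \<open>f\<close> on all inputs from \<open>X\<close>, in time polynomial
  in the size of the encoded input. Input and output are passed in variable 0.
\<close>

definition polytime_on ::
  "('a \<Rightarrow> sexp) \<Rightarrow> ('b \<Rightarrow> sexp) \<Rightarrow> 'a set \<Rightarrow> ('a \<Rightarrow> 'b) \<Rightarrow> bool" where
  "polytime_on enc enc' X f \<longleftrightarrow>
     (\<exists>(c :: com) (p :: nat poly). \<forall>x\<in>X. \<exists>t s.
        exec c ((\<lambda>_. Atom)(0 := enc x)) t s \<and> s 0 = enc' (f x) \<and> t \<le> poly p (size (enc x)))"

section \<open>Encodings\<close>

text \<open>Numbers are encoded in binary, least significant bit first.\<close>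

fun enc_nat :: "nat \<Rightarrow> sexp" where
  "enc_nat n =
     (if n = 0 then Atom
      else Cell (if odd n then Cell Atom Atom else Atom) (enc_nat (n div 2)))"

declare enc_nat.simps [simp del]

fun enc_pair :: "('a \<Rightarrow> sexp) \<Rightarrow> ('b \<Rightarrow> sexp) \<Rightarrow> 'a \<times> 'b \<Rightarrow> sexp" where
  "enc_pair ea eb (x, y) = Cell (ea x) (eb y)"

fun enc_list :: "('a \<Rightarrow> sexp) \<Rightarrow> 'a list \<Rightarrow> sexp" where
  "enc_list ea [] = Atom"
| "enc_list ea (x # xs) = Cell (ea x) (enc_list ea xs)"

text \<open>
  A rooted tree is presented to a program as a list of its vertices, a list of its undirected
  edges (each given once, in either orientation), and its root.
\<close>

type_synonym tree_rep = "nat list \<times> (nat \<times> nat) list \<times> nat"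

definition enc_tree :: "tree_rep \<Rightarrow> sexp" where
  "enc_tree = enc_pair (enc_list enc_nat) (enc_pair (enc_list (enc_pair enc_nat enc_nat)) enc_nat)"

fun graph_of :: "tree_rep \<Rightarrow> nat pair_pre_digraph" where
  "graph_of (vs, es, r) = \<lparr> pverts = set vs, parcs = set es \<union> (set es)\<inverse> \<rparr>"

fun root_of :: "tree_rep \<Rightarrow> nat" where
  "root_of (vs, es, r) = r"

fun valid_tree_rep :: "tree_rep \<Rightarrow> bool" where
  "valid_tree_rep (vs, es, r) \<longleftrightarrow>
     distinct vs \<and> distinct (map (\<lambda>(u, v). {u, v}) es) \<and> rooted_tree (graph_of (vs, es, r)) r"

end

theory Submission
  imports Defs "HOL-Real_Asymp.Real_Asymp"
begin

text \<open>
  Call a level \<open>l\<close> a start level if \<open>l + 1\<close> is a power of 2, and let the anchor of a vertex be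
  its lowest ancestor (possibly itself) on a start level. The compressed tree consists of vertices
  on start levels, joined to the anchors of their parents, so that the vertices of its level \<open>m\<close>
  are on level \<open>2 ^ m - 1\<close> of \<open>G\<close>. Since \<open>2 + 4 + \<dots> + 2 ^ m = 2 * (2 ^ m - 1)\<close>, a
  solution for the compressed tree satisfies the budget \<open>2 * B\<close> in \<open>G\<close> unchanged; conversely,
  replacing protected vertices by their anchors moves those counted up to level \<open>m\<close> from
  levels up to \<open>2 ^ (m + 1) - 2\<close> of \<open>G\<close>, which is exactly what the cumulative budget allows.

  A leaf of \<open>G\<close> between two start levels may have an anchor with further descendants on the next
  start level. Such an anchor has to be made a leaf, so everything strictly below the anchor of a
  leaf is pruned: any solution in \<open>G\<close> protects an ancestor of that leaf anyway.
\<close>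

section \<open>Rooted trees as parent functions\<close>

text \<open>The locale below trades the cycle-based notion of a tree for a parent function together
  with a level that drops by one along it, so that later arguments become inductions on levels; both
  directions of the translation are proved once. Since the vertices of the compressed tree are
  vertices of \<open>G\<close>, part (ii) only has to return the given set, and only the
  construction of the tree poses a question of efficiency. The obstacle there is the machine model:
  instead of one explicit program, the polynomial-time functions on \<open>sexp\<close> are shown to
  be closed under pairing, case distinction and folds over lists. Folds are delicate, since
  iterating a polynomial-time step may double the accumulator each time; accumulators are therefore
  bounded in advance, for inner loops by additive growth and for the outer loop by the invariant of
  the search. The pruning fits into a single level-by-level search: when a start level is about to
  be entered, all live vertices that share an anchor with the current level have been visited, so it
  is known by then which of these anchors are leaf anchors.\<close>

locale parent_tree =
  fixes V :: "'a set" and r :: 'a and par :: "'a \<Rightarrow> 'a" and lev :: "'a \<Rightarrow> nat"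
  assumes finite_V: "finite V"
    and root_in: "r \<in> V"
    and lev_root: "lev r = 0"
    and par_in: "v \<in> V \<Longrightarrow> v \<noteq> r \<Longrightarrow> par v \<in> V"
    and lev_par: "v \<in> V \<Longrightarrow> v \<noteq> r \<Longrightarrow> lev v = Suc (lev (par v))"

definition tree_graph :: "'a set \<Rightarrow> 'a \<Rightarrow> ('a \<Rightarrow> 'a) \<Rightarrow> 'a pair_pre_digraph" where
  "tree_graph V r par =
     \<lparr> pverts = V, parcs = (\<Union>v\<in>V - {r}. {(v, par v), (par v, v)}) \<rparr>"

text \<open>The guard \<open>u \<noteq> r\<close> stops the climb at the root, where the locale says
  nothing about \<open>par\<close>.\<close>

inductive_set anc :: "'a \<Rightarrow> ('a \<Rightarrow> 'a) \<Rightarrow> 'a \<Rightarrow> 'a set"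
  for r :: 'a and par :: "'a \<Rightarrow> 'a" and v :: 'a where
  anc_refl: "v \<in> anc r par v"
| anc_par: "u \<in> anc r par v \<Longrightarrow> u \<noteq> r \<Longrightarrow> par u \<in> anc r par v"

lemma anc_root: "anc r par r = {r}"
proof -
  have "x = r" if "x \<in> anc r par r" for x
    using that by (induction rule: anc.induct) auto
  then show ?thesis by (auto intro: anc_refl)
qed

lemma anc_step: "v \<noteq> r \<Longrightarrow> anc r par v = insert v (anc r par (par v))"
proof (intro equalityI subsetI)
  fix x assume "v \<noteq> r" "x \<in> anc r par v"
  from this(2) show "x \<in> insert v (anc r par (par v))"
    by (induction rule: anc.induct) (auto intro: anc.intros)
next
  fix x assume v: "v \<noteq> r" and "x \<in> insert v (anc r par (par v))"
  moreover have "y \<in> anc r par v" if "y \<in> anc r par (par v)" for y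
    using that
  proof induction
    case anc_refl
    show ?case using anc.anc_par[OF anc.anc_refl v] .
  qed (rule anc.anc_par)
  ultimately show "x \<in> anc r par v" by (auto intro: anc_refl)
qed

lemma anc_trans: "x \<in> anc r par u \<Longrightarrow> u \<in> anc r par v \<Longrightarrow> x \<in> anc r par v"
  by (induction rule: anc.induct) (auto intro: anc.intros)

lemma nth_pawalk:
  assumes "pcas u p v" "i < length p"
  shows "p ! i = (pawalk_verts u p ! i, pawalk_verts u p ! Suc i)"
  using assms
proof (induction p arbitrary: u i)
  case (Cons e p)
  then show ?case by (cases i; cases p) (auto simp: prod_eq_iff)
qed simp

lemma pawalk_verts_ends:
  assumes "pcas u p v"
  shows "pawalk_verts u p ! 0 = u" "pawalk_verts u p ! length p = v"
  using assms by (induction p arbitrary: u) auto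

lemma vwalk_arcs_append_last:
  "p \<noteq> [] \<Longrightarrow> vwalk_arcs (p @ [v]) = vwalk_arcs p @ [(last p, v)]"
  by (induction p rule: vwalk_arcs.induct) auto

context parent_tree begin

abbreviation "T \<equiv> tree_graph V r par"

lemma pverts_T [simp]: "pverts T = V"
  by (simp add: tree_graph_def)

lemma parcs_T: "(u, v) \<in> parcs T \<longleftrightarrow>
    (u \<in> V \<and> u \<noteq> r \<and> v = par u) \<or> (v \<in> V \<and> v \<noteq> r \<and> u = par v)"
  by (auto simp: tree_graph_def)

lemma lev_eq_0_iff: "v \<in> V \<Longrightarrow> lev v = 0 \<longleftrightarrow> v = r"
  using lev_par lev_root by fastforce

lemma par_neq: "v \<in> V \<Longrightarrow> v \<noteq> r \<Longrightarrow> par v \<noteq> v"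
  using lev_par by fastforce

lemma pair_graph_T: "pair_graph T"
proof unfold_locales
  fix e assume "e \<in> parcs T"
  then show "fst e \<in> pverts T" "snd e \<in> pverts T" "fst e \<noteq> snd e"
    by (cases e; auto simp: parcs_T par_in par_neq[symmetric] dest: par_neq)+
next
  show "finite (pverts T)" "finite (parcs T)"
    by (auto simp: finite_V tree_graph_def)
  show "symmetric T"
    by (auto simp: symmetric_def parcs_T intro!: symI)
qed

sublocale T: pair_graph T by (rule pair_graph_T)

lemma anc_in_V: "v \<in> V \<Longrightarrow> anc r par v \<subseteq> V"
proof
  fix x assume "v \<in> V" "x \<in> anc r par v"
  from this(2,1) show "x \<in> V" by induction (auto intro: par_in)
qed

lemma lev_induct [consumes 1, case_names root step]:
  assumes "v \<in> V" "P r"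
    and "\<And>v. v \<in> V \<Longrightarrow> v \<noteq> r \<Longrightarrow> P (par v) \<Longrightarrow> P v"
  shows "P v"
  using assms(1)
proof (induction "lev v" arbitrary: v)
  case 0
  then show ?case using lev_eq_0_iff assms(2) by simp
next
  case (Suc n)
  then have "v \<noteq> r" using lev_root by auto
  moreover have "lev (par v) = n" using lev_par[OF Suc.prems \<open>v \<noteq> r\<close>] Suc.hyps(2) by simp
  ultimately show ?case using Suc assms(3) par_in by blast
qed

lemma lev_anc: "v \<in> V \<Longrightarrow> u \<in> anc r par v \<Longrightarrow> lev u \<le> lev v"
proof -
  assume v: "v \<in> V" and u: "u \<in> anc r par v"
  from u have "u \<in> anc r par v \<and> lev u \<le> lev v"
  proof induction
    case (anc_par u)
    then have "u \<in> V" using anc_in_V v by auto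
    then show ?case using anc_par lev_par[of u] by (auto intro: anc.anc_par)
  qed (auto intro: anc_refl)
  then show ?thesis ..
qed

lemma awalk_to:
  assumes "v \<in> V" shows "\<exists>p. T.awalk r p v \<and> length p = lev v"
  using assms
proof (induction rule: lev_induct)
  case root
  have "T.awalk r [] r" using root_in by (simp add: T.awalk_Nil_iff)
  then show ?case by (intro exI[of _ "[]"]) (auto simp: lev_root)
next
  case (step v)
  then obtain p where p: "T.awalk r p (par v)" "length p = lev (par v)" by auto
  have "T.awalk (par v) [(par v, v)] v"
    using step by (auto simp: T.awalk_simps parcs_T)
  from T.awalk_appendI[OF p(1) this] p(2) show ?case
    using lev_par[OF step(1,2)] by (intro exI[of _ "p @ [(par v, v)]"]) auto
qed

text \<open>Every arc changes the level by exactly one, up or down. With \<open>awalk_to\<close>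
  this identifies \<open>lev\<close> with the distance from the root.\<close>

lemma lev_le_awalk:
  assumes "T.awalk u p v" shows "lev v \<le> lev u + length p"
  using assms
proof (induction p arbitrary: u)
  case (Cons e p)
  then have "e \<in> parcs T" "u = fst e" "lev v \<le> lev (snd e) + length p"
    by (auto simp: T.awalk_simps)
  then show ?case using lev_par[of "fst e"] lev_par[of "snd e"]
    by (cases e) (auto simp: parcs_T)
qed (auto simp: T.awalk_simps)

lemma level_T: "v \<in> V \<Longrightarrow> level T r v = lev v"
  unfolding level_def
  using awalk_to[of v] lev_le_awalk[of r _ v] lev_root
  by (intro Least_equality) auto

lemma depth_T: "depth T r = Max (lev ` V)"
  unfolding depth_def by (simp add: level_T cong: image_cong)

lemma lev_le_depth: "v \<in> V \<Longrightarrow> lev v \<le> depth T r"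
  unfolding depth_T using finite_V by simp

lemma leaves_T: "leaves T r = {v \<in> V. \<forall>w\<in>V - {r}. par w \<noteq> v}"
proof -
  have "(\<exists>w. (v, w) \<in> parcs T \<and> level T r v < level T r w) \<longleftrightarrow> (\<exists>w\<in>V - {r}. par w = v)"
    if "v \<in> V" for v
  proof
    assume "\<exists>w. (v, w) \<in> parcs T \<and> level T r v < level T r w"
    then obtain w where w: "(v, w) \<in> parcs T" "level T r v < level T r w" by auto
    then have "w \<in> V" using par_in by (auto simp: parcs_T)
    then have "lev v < lev w" using w that by (simp add: level_T)
    then show "\<exists>w\<in>V - {r}. par w = v" using w(1) lev_par by (fastforce simp: parcs_T)
  next
    assume "\<exists>w\<in>V - {r}. par w = v"
    then obtain w where "w \<in> V" "w \<noteq> r" "par w = v" by auto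
    then show "\<exists>w. (v, w) \<in> parcs T \<and> level T r v < level T r w"
      using that lev_par by (intro exI[of _ w]) (auto simp: parcs_T level_T)
  qed
  then show ?thesis by (auto simp: leaves_def)
qed

lemma connected_T: "Digraph_Component.connected T"
proof -
  have r: "reachable T r v" if "v \<in> V" for v
    using awalk_to[OF that] T.reachable_awalk by blast
  have "reachable T u v" if "u \<in> V" "v \<in> V" for u v
    using r[OF that(1)] r[OF that(2)] T.reachable_trans
      symmetric_reachable[OF T.pair_sym_arcs] by blast
  then show ?thesis
    unfolding Digraph_Component.connected_def strongly_connected_def
    using root_in by (auto simp: T.reachable_mk_symmetric_eq[OF T.pair_sym_arcs])
qed

text \<open>Look at a vertex of maximal level on the cycle: its predecessor and its successor there
  can only be its parent, so they coincide, which distinctness forbids unless the cycle just goes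
  back and forth.\<close>

lemma no_cycle_T: "\<not> (T.cycle p \<and> length p \<ge> 3)"
proof
  assume "T.cycle p \<and> length p \<ge> 3"
  then obtain u where u: "T.awalk u p u" "distinct (tl (pawalk_verts u p))" "length p \<ge> 3"
    by (auto simp: T.cycle_def)
  define k where "k = length p"
  define x where "x = nth (pawalk_verts u p)"
  have cas: "pcas u p u" and sub: "set p \<subseteq> parcs T" using u(1) by (auto simp: T.awalk_def)
  have len: "length (pawalk_verts u p) = Suc k"
    unfolding k_def by (rule T.length_awalk_verts)
  have arcs: "(x i, x (Suc i)) \<in> parcs T" if "i < k" for i
    using sub that nth_pawalk[OF cas] unfolding k_def x_def by (metis nth_mem subsetD)
  have ends: "x 0 = x k" using pawalk_verts_ends[OF cas] unfolding x_def k_def by simp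
  have verts: "x i \<in> V" if "i \<le> k" for i
  proof (cases "i < k")
    case True
    then show ?thesis using arcs[OF True] par_in by (auto simp: parcs_T)
  next
    case False
    then have "i = Suc (k - 1)" "k - 1 < k" using that u(3) unfolding k_def by auto
    then show ?thesis using arcs[of "k - 1"] par_in by (auto simp: parcs_T)
  qed
  \<comment> \<open>Distinctness concerns the tail of the vertex list, that is \<open>x 1\<close> to
    \<open>x k\<close>; hence the shifted indices.\<close>
  have inj: "i = j" if "x (Suc i) = x (Suc j)" "i < k" "j < k" for i j
    using u(2) that len unfolding x_def by (simp add: nth_tl[symmetric] nth_eq_iff_index_eq)
  have k: "k \<ge> 3" using u(3) k_def by simp
  have "Max ((\<lambda>j. lev (x (Suc j))) ` {..<k}) \<in> (\<lambda>j. lev (x (Suc j))) ` {..<k}"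
    using k by (intro Max_in) (auto simp: lessThan_empty_iff)
  then obtain i where i: "i < k" and i_Max: "lev (x (Suc i)) = Max ((\<lambda>j. lev (x (Suc j))) ` {..<k})"
    by auto
  have max: "lev (x (Suc j)) \<le> lev (x (Suc i))" if "j < k" for j
    unfolding i_Max using that by (intro Max_ge) auto
  have down: "y = par v" if "(y, v) \<in> parcs T" "lev y \<le> lev v" for y v
    using that lev_par[of y] by (auto simp: parcs_T)
  have max': "lev (x j) \<le> lev (x (Suc i))" if "j \<le> k" for j
    using max[of "j - 1"] max[of "k - 1"] that k ends by (cases j) auto
  \<comment> \<open>The successor of the highest-level vertex \<open>x (Suc i)\<close>; at the end
    of the list it wraps around to 1, because \<open>x k = x 0\<close>.\<close>
  define s where "s = (if Suc i = k then 1 else Suc (Suc i))"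
  have pre: "x i = par (x (Suc i))"
    by (rule down[OF arcs[OF i] max']) (use i in simp)
  have "(x (Suc i), x s) \<in> parcs T"
    using arcs[of "Suc i"] arcs[of 0] ends i k unfolding s_def by auto
  then have "(x s, x (Suc i)) \<in> parcs T" by (rule T.arcs_symmetric)
  then have "x s = par (x (Suc i))"
    by (rule down[OF _ max']) (use i k in \<open>auto simp: s_def\<close>)
  then have eq: "x s = x i" using pre by simp
  show False
  proof (cases i)
    case 0
    then show ?thesis using eq ends inj[of "Suc 0" "k - 1"] k unfolding s_def by auto
  next
    case (Suc i')
    then show ?thesis using eq inj[of "s - 1" i'] i k unfolding s_def by (auto split: if_splits)
  qed
qed

lemma rooted_tree_T: "rooted_tree T r"
  using pair_graph_T connected_T no_cycle_T root_in by (auto simp: rooted_tree_def)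

text \<open>A step of the walk leads to a child, whose ancestors are itself and those already
  visited, or to the parent, whose ancestors have all been visited.\<close>

lemma anc_subset_vwalk:
  assumes "vwalk p T" "hd p = r" shows "anc r par (last p) \<subseteq> set p"
  using assms
proof (induction p rule: rev_induct)
  case (snoc v p)
  show ?case
  proof (cases "p = []")
    case True
    then show ?thesis using snoc anc_root[of r par] by auto
  next
    case False
    have "vwalk p T" using snoc.prems(1) False vwalk_arcs_append_last[of p v] by (auto simp: vwalk_def)
    moreover have "hd p = r" using snoc.prems(2) False by simp
    ultimately have IH: "anc r par (last p) \<subseteq> set p" using snoc.IH by simp
    have "(last p, v) \<in> parcs T"
      using snoc.prems(1) False vwalk_arcs_append_last[of p v] by (auto simp: vwalk_def)
    then have "anc r par v \<subseteq> insert v (anc r par (last p))"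
      using anc_step[of v r par] anc_step[of "last p" r par] by (auto simp: parcs_T)
    then show ?thesis using IH by auto
  qed
qed (simp add: vwalk_def)

lemma vpath_to:
  assumes "v \<in> V" shows "\<exists>p. vpath p T \<and> hd p = r \<and> last p = v \<and> set p = anc r par v"
  using assms
proof (induction rule: lev_induct)
  case root
  then show ?case using root_in by (intro exI[of _ "[r]"]) (auto simp: vpath_def vwalk_def anc_root)
next
  case (step v)
  then obtain p where p: "vpath p T" "hd p = r" "last p = par v" "set p = anc r par (par v)" by auto
  have ne: "p \<noteq> []" using p(1) by (auto simp: vpath_def vwalk_def)
  have "v \<notin> set p"
    using lev_anc[OF par_in[OF step(1,2)]] lev_par[OF step(1,2)] p(4) by fastforce
  then show ?case using p ne step(1,2) vwalk_arcs_append_last[OF ne, of v] anc_step[OF step(2), of par]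
    by (intro exI[of _ "p @ [v]"]) (auto simp: vpath_def vwalk_def parcs_T)
qed

text \<open>Every path from the root to a leaf contains all ancestors of the leaf, and one of them
  contains nothing else, so hitting all paths means hitting all ancestor sets. The lower bound 1 on
  levels is automatic because the root is not in \<open>S\<close>.\<close>

lemma rmfc_solution_T:
  "rmfc_solution T r B S \<longleftrightarrow> S \<subseteq> V - {r} \<and>
     (\<forall>l\<in>{1..depth T r}. card (S \<inter> {v. lev v \<le> l}) \<le> (\<Sum>i=1..l. B i)) \<and>
     (\<forall>v\<in>leaves T r. anc r par v \<inter> S \<noteq> {})"
proof -
  have lev: "S \<inter> {v \<in> V. 1 \<le> level T r v \<and> level T r v \<le> l} = S \<inter> {v. lev v \<le> l}"
    if "S \<subseteq> V - {r}" for l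
  proof -
    have "1 \<le> lev v" if "v \<in> S" for v
      using lev_eq_0_iff[of v] \<open>S \<subseteq> V - {r}\<close> that by auto
    then show ?thesis using that by (auto simp: level_T)
  qed
  have paths: "(\<forall>p. vpath p T \<and> hd p = r \<and> last p \<in> leaves T r \<longrightarrow> set p \<inter> S \<noteq> {}) \<longleftrightarrow>
      (\<forall>v\<in>leaves T r. anc r par v \<inter> S \<noteq> {})" (is "?L \<longleftrightarrow> ?R")
  proof
    assume ?L
    show ?R
    proof
      fix v assume v: "v \<in> leaves T r"
      then have "v \<in> V" by (simp add: leaves_T)
      then show "anc r par v \<inter> S \<noteq> {}" using vpath_to[of v] \<open>?L\<close> v by metis
    qed
  next
    assume ?R
    then show ?L using anc_subset_vwalk unfolding vpath_def by blast
  qed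
  show ?thesis unfolding rmfc_solution_def paths using lev by (auto simp del: One_nat_def)
qed

end

section \<open>Every rooted tree comes from a parent function\<close>

context
  fixes G :: "'a pair_pre_digraph" and r :: 'a
  assumes tree: "rooted_tree G r"
begin

interpretation G: pair_graph G using tree by (simp add: rooted_tree_def)

private lemma reach: "v \<in> pverts G \<Longrightarrow> \<exists>p. G.awalk r p v"
  using tree G.reachable_awalk G.reachable_mk_symmetric_eq[OF G.pair_sym_arcs]
  by (auto simp: rooted_tree_def Digraph_Component.connected_def strongly_connected_def)

private lemma level_le: "G.awalk r p v \<Longrightarrow> level G r v \<le> length p"
  unfolding level_def by (rule Least_le) auto

private lemma level_attained:
  assumes "v \<in> pverts G" shows "\<exists>p. G.awalk r p v \<and> length p = level G r v"
  unfolding level_def by (rule LeastI_ex) (use reach[OF assms] in auto)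

text \<open>Cut off the last arc of a shortest walk to \<open>v\<close>. The remaining walk is again
  shortest, since a shorter one could be extended by that arc.\<close>

private lemma parent_exists:
  assumes "v \<in> pverts G" "v \<noteq> r"
  shows "\<exists>u. (u, v) \<in> parcs G \<and> level G r v = Suc (level G r u)"
proof -
  obtain p where p: "G.awalk r p v" "length p = level G r v" using level_attained assms by blast
  have "p \<noteq> []" using p(1) assms(2) by (auto simp: G.awalk_Nil_iff)
  then obtain q e where q: "p = q @ [e]" by (metis rev_exhaust)
  then obtain u where e: "e = (u, v)" "(u, v) \<in> parcs G" "G.awalk r q u"
    using p(1) by (cases e) (auto simp: G.awalk_simps)
  obtain p' where p': "G.awalk r p' u" "length p' = level G r u"
    using level_attained e(2) G.wellformed' by blast
  have "G.awalk u [(u, v)] v" using e(2) G.wellformed' by (auto simp: G.awalk_simps)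
  then have "level G r v \<le> length (p' @ [(u, v)])"
    by (intro level_le G.awalk_appendI[OF p'(1)])
  then show ?thesis using level_le[OF e(3)] p p'(2) q e by auto
qed

text \<open>Choose a parent for each vertex. An arc outside the resulting graph would join two
  vertices that are already connected in it by a path of length at least 2, and so close a cycle of
  length at least 3.\<close>

lemma rooted_tree_parent_tree:
  "\<exists>par. parent_tree (pverts G) r par (level G r) \<and> G = tree_graph (pverts G) r par"
proof -
  obtain par where par: "\<And>v. v \<in> pverts G \<Longrightarrow> v \<noteq> r \<Longrightarrow>
      (par v, v) \<in> parcs G \<and> level G r v = Suc (level G r (par v))"
    using parent_exists by metis
  have r: "r \<in> pverts G" using tree by (simp add: rooted_tree_def)
  have "level G r r = 0" using level_le[of "[]" r] r by (simp add: G.awalk_Nil_iff)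
  then interpret P: parent_tree "pverts G" r par "level G r"
    using par r G.wellformed' by unfold_locales (auto simp: G.pair_finite_verts)
  have sub: "parcs P.T \<subseteq> parcs G" using par G.arcs_symmetric by (auto simp: tree_graph_def)
  have "(x, y) \<in> parcs P.T" if xy: "(x, y) \<in> parcs G" for x y
  proof (rule ccontr)
    assume no: "(x, y) \<notin> parcs P.T"
    then have no': "(y, x) \<notin> parcs P.T" using P.T.arcs_symmetric by blast
    have "x \<noteq> y" using G.no_loops' xy by blast
    have "reachable P.T y x"
      using P.connected_T xy G.wellformed'
      by (auto simp: Digraph_Component.connected_def strongly_connected_def
          P.T.reachable_mk_symmetric_eq[OF P.T.pair_sym_arcs])
    then obtain p where p: "P.T.apath y p x" using P.T.reachable_apath by blast
    have "length p \<ge> 2"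
      using p no' \<open>x \<noteq> y\<close>
      by (cases p; cases "tl p") (auto simp: P.T.apath_simps Suc_le_eq)
    moreover have "G.awalk x ((x, y) # p) x"
      using p sub xy G.wellformed' by (auto simp: P.T.apath_def P.T.awalk_def G.awalk_def)
    moreover have "distinct (pawalk_verts y p)" using p by (simp add: P.T.apath_def)
    ultimately have "G.cycle ((x, y) # p) \<and> length ((x, y) # p) \<ge> 3"
      unfolding G.cycle_def by (auto intro!: exI[of _ x])
    then show False using tree unfolding rooted_tree_def by blast
  qed
  then have "parcs G = parcs P.T" using sub by auto
  then have "G = P.T" by (intro pair_pre_digraph.equality) auto
  then show ?thesis using P.parent_tree_axioms by blast
qed

end

section \<open>The compressed tree\<close>

definition start :: "nat \<Rightarrow> bool" where
  "start l \<longleftrightarrow> (\<exists>m. Suc l = 2 ^ m)"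

lemma start_0 [simp]: "start 0"
  unfolding start_def by (intro exI[of _ 0]) simp

context parent_tree begin

text \<open>The first argument is meant to be the level of the second; recursion on it makes the
  climb along \<open>par\<close> terminate.\<close>

fun anchor_at :: "nat \<Rightarrow> 'a \<Rightarrow> 'a" where
  "anchor_at 0 v = v"
| "anchor_at (Suc l) v = (if start (Suc l) then v else anchor_at l (par v))"

definition anchor :: "'a \<Rightarrow> 'a" where
  "anchor v = anchor_at (lev v) v"

definition leaf_anchor :: "'a \<Rightarrow> bool" where
  "leaf_anchor a \<longleftrightarrow> (\<exists>v\<in>leaves T r. anchor v = a)"

text \<open>Pruning happens only on entering a start level, so all vertices with the same anchor
  share its fate. Vertices between two start levels stay alive below a leaf anchor: they are not in
  \<open>V'\<close> anyway, and the search must visit them to find the leaves that make their anchor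
  a leaf anchor.\<close>

inductive live :: "'a \<Rightarrow> bool" where
  live_root: "live r"
| live_step: "v \<in> V \<Longrightarrow> v \<noteq> r \<Longrightarrow> live (par v) \<Longrightarrow> (start (lev v) \<Longrightarrow> \<not> leaf_anchor (anchor (par v))) \<Longrightarrow> live v"

definition V' :: "'a set" where
  "V' = {v. live v \<and> start (lev v)}"

definition par' :: "'a \<Rightarrow> 'a" where
  "par' v = anchor (par v)"

definition lev' :: "'a \<Rightarrow> nat" where
  "lev' v = (LEAST m. Suc (lev v) \<le> 2 ^ m)"

lemma anchor_root [simp]: "anchor r = r"
  by (simp add: anchor_def lev_root)

lemma anchor_start: "start (lev v) \<Longrightarrow> anchor v = v"
  by (cases "lev v") (auto simp: anchor_def)

lemma anchor_par: "v \<in> V \<Longrightarrow> \<not> start (lev v) \<Longrightarrow> anchor v = anchor (par v)"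
  using lev_par[of v] lev_root by (cases "v = r") (auto simp: anchor_def)

text \<open>In the block of levels from \<open>2 ^ m - 1\<close> to \<open>2 ^ Suc m - 2\<close>
  only the first is a start level, so the climb from anywhere in the block ends there.\<close>

lemma lev_anchor:
  assumes "v \<in> V" "2 ^ m \<le> Suc (lev v)" "Suc (lev v) < 2 ^ Suc m"
  shows "Suc (lev (anchor v)) = 2 ^ m"
  using assms
proof (induction rule: lev_induct)
  case root
  then have "(2::nat) ^ m \<le> 2 ^ 0" by (simp add: lev_root)
  then have "m = 0" using power_le_imp_le_exp[of "2::nat" m 0] by simp
  then show ?case by (simp add: lev_root)
next
  case (step v)
  show ?case
  proof (cases "start (lev v)")
    case True
    then obtain k where k: "Suc (lev v) = 2 ^ k" by (auto simp: start_def)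
    have "m \<le> k" by (rule power_le_imp_le_exp[of "2::nat"]) (use k step.prems in auto)
    moreover have "k < Suc m" by (rule power_less_imp_less_exp[of "2::nat"]) (use k step.prems in auto)
    ultimately have "k = m" by simp
    then show ?thesis using k anchor_start[OF True] by simp
  next
    case False
    then have "Suc (lev v) \<noteq> 2 ^ m" by (auto simp: start_def)
    then show ?thesis
      using step lev_par[OF step.hyps(1,2)] anchor_par[OF step.hyps(1) False] by auto
  qed
qed

lemma ex_group: "\<exists>m. 2 ^ m \<le> Suc l \<and> Suc l < 2 ^ Suc m"
  using ex_power_ivl1[of 2 "Suc l"] by auto

lemma start_anchor: "v \<in> V \<Longrightarrow> start (lev (anchor v))"
proof -
  assume v: "v \<in> V"
  obtain m where m: "2 ^ m \<le> Suc (lev v)" "Suc (lev v) < 2 ^ Suc m"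
    using ex_group by blast
  show ?thesis unfolding start_def using lev_anchor[OF v m] by blast
qed

lemma anchor_in_anc: "v \<in> V \<Longrightarrow> anchor v \<in> anc r par v"
proof (induction rule: lev_induct)
  case (step v)
  then show ?case using anchor_start[of v] anchor_par[of v] anc_step[of v r par]
    by (cases "start (lev v)") (auto intro: anc_refl)
qed (auto intro: anc_refl)

lemma anchor_in_V: "v \<in> V \<Longrightarrow> anchor v \<in> V"
  using anchor_in_anc anc_in_V by auto

lemma lev_anchor_le: "v \<in> V \<Longrightarrow> lev (anchor v) \<le> lev v"
  using anchor_in_anc lev_anc by auto

text \<open>The climb to the anchor stops at the first start level it meets, so it never passes
  one.\<close>

lemma start_le_lev_anchor:
  assumes "v \<in> V" "start s" "s \<le> lev v" shows "s \<le> lev (anchor v)"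
proof -
  obtain m where m: "2 ^ m \<le> Suc (lev v)" "Suc (lev v) < 2 ^ Suc m"
    using ex_group by blast
  obtain k where k: "Suc s = 2 ^ k" using assms(2) by (auto simp: start_def)
  have "2 ^ k < (2::nat) ^ Suc m" using k m assms(3) by linarith
  then have "k < Suc m" by (rule power_less_imp_less_exp[rotated]) simp
  then have "(2::nat) ^ k \<le> 2 ^ m" by (intro power_increasing) auto
  then show ?thesis using k lev_anchor[OF assms(1) m] by linarith
qed

text \<open>Level 1 is a start level, so nothing else is anchored at the root. Hence replacing
  protected vertices by anchors never protects the root.\<close>

lemma anchor_eq_root_iff: "v \<in> V \<Longrightarrow> anchor v = r \<longleftrightarrow> v = r"
proof
  assume v: "v \<in> V" "anchor v = r"
  have "start 1" unfolding start_def by (intro exI[of _ 1]) simp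
  then have "\<not> 1 \<le> lev v" using start_le_lev_anchor[OF v(1)] v(2) lev_root by fastforce
  then show "v = r" using lev_eq_0_iff[OF v(1)] by simp
qed simp

lemma live_in_V: "live v \<Longrightarrow> v \<in> V"
  by (induction rule: live.induct) (auto simp: root_in)

lemma live_iff: "live v \<longleftrightarrow> v = r \<or>
    v \<in> V \<and> v \<noteq> r \<and> live (par v) \<and> (start (lev v) \<longrightarrow> \<not> leaf_anchor (anchor (par v)))"
  by (subst live.simps) (auto simp: live.simps[of r] intro: live_root)

lemma live_anchor_iff: "v \<in> V \<Longrightarrow> live (anchor v) \<longleftrightarrow> live v"
proof (induction rule: lev_induct)
  case (step v)
  show ?case
  proof (cases "start (lev v)")
    case False
    then show ?thesis using step anchor_par[OF step(1) False] live_iff[of v] by simp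
  qed (simp add: anchor_start)
qed simp

lemma anchor_in_V'_iff: "v \<in> V \<Longrightarrow> anchor v \<in> V' \<longleftrightarrow> live v"
  by (simp add: V'_def live_anchor_iff start_anchor)

lemma V'_subset: "V' \<subseteq> V"
  using live_in_V by (auto simp: V'_def)

lemma anchor_V': "v \<in> V' \<Longrightarrow> anchor v = v"
  by (simp add: V'_def anchor_start)

lemma lev'_eqI: "Suc (lev v) = 2 ^ m \<Longrightarrow> lev' v = m"
  unfolding lev'_def by (intro Least_equality) auto

lemma Suc_lev: "v \<in> V' \<Longrightarrow> Suc (lev v) = 2 ^ lev' v"
proof -
  assume "v \<in> V'"
  then obtain m where "Suc (lev v) = 2 ^ m" by (auto simp: V'_def start_def)
  then show ?thesis using lev'_eqI by simp
qed

lemma parent_tree': "parent_tree V' r par' lev'"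
proof
  show "finite V'" using V'_subset finite_V finite_subset by blast
  show r: "r \<in> V'" by (simp add: V'_def live_root lev_root)
  show "lev' r = 0" by (rule lev'_eqI) (simp add: lev_root)
  fix v assume v: "v \<in> V'" "v \<noteq> r"
  then have vV: "v \<in> V" using V'_subset by auto
  have pV: "par v \<in> V" using par_in[OF vV v(2)] .
  have "live (par v)" using v live_iff[of v] by (auto simp: V'_def)
  then show p: "par' v \<in> V'" using anchor_in_V'_iff[OF pV] by (simp add: par'_def)
  obtain m where m: "lev' v = Suc m"
    using Suc_lev[OF v(1)] lev_eq_0_iff[OF vV] v(2) by (cases "lev' v") auto
  \<comment> \<open>The parent lies on level \<open>2 ^ Suc m - 2\<close>, the last one of block
    \<open>m\<close>, so its anchor is on level \<open>2 ^ m - 1\<close>.\<close>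
  have "Suc (lev (par v)) + 1 = 2 ^ Suc m" using Suc_lev[OF v(1)] m lev_par[OF vV v(2)] by simp
  moreover have "(1::nat) \<le> 2 ^ m" by simp
  ultimately have "Suc (lev (anchor (par v))) = 2 ^ m" by (intro lev_anchor[OF pV]) auto
  then show "lev' v = Suc (lev' (par' v))" using lev'_eqI m by (simp add: par'_def)
qed

interpretation C: parent_tree V' r par' lev' by (rule parent_tree')

lemma anc'_subset: "v \<in> V' \<Longrightarrow> anc r par' v \<subseteq> anc r par v"
proof
  fix u assume v: "v \<in> V'" and u: "u \<in> anc r par' v"
  from u have "u \<in> anc r par v \<and> u \<in> V"
  proof induction
    case (anc_par u)
    then have "par u \<in> V" "par u \<in> anc r par v"
      using par_in by (auto intro: anc.anc_par)
    then show ?case using anchor_in_anc anc_trans anchor_in_V unfolding par'_def by metis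
  qed (use v V'_subset in \<open>auto intro: anc_refl\<close>)
  then show "u \<in> anc r par v" ..
qed

text \<open>Along the climb in \<open>G\<close> the anchor changes only on leaving a start level,
  and then from \<open>u\<close> to \<open>par' u\<close>.\<close>

lemma anchor_anc: "u \<in> anc r par v \<Longrightarrow> v \<in> V \<Longrightarrow> anchor u \<in> anc r par' (anchor v)"
proof (induction rule: anc.induct)
  case (anc_par u)
  then have u: "u \<in> V" using anc_in_V by auto
  have anchor: "anchor u \<in> anc r par' (anchor v)" using anc_par by simp
  show ?case
  proof (cases "start (lev u)")
    case True
    then have "anchor u = u" by (rule anchor_start)
    then show ?thesis using anc.anc_par[of "anchor u" r par' "anchor v"] anchor anc_par(2)
      by (simp add: par'_def[symmetric] True)
  qed (use anchor anchor_par[OF u] in simp)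
qed (rule anc_refl)

text \<open>The purpose of the pruning: leaf anchors lose all their children, while any other vertex
  of \<open>V'\<close> keeps one because the vertices anchored at it must continue to the next start
  level.\<close>

lemma leaves_C: "leaves C.T r = {v \<in> V'. leaf_anchor v}"
proof (intro equalityI subsetI CollectI conjI)
  fix w assume "w \<in> leaves C.T r"
  then have w: "w \<in> V'" and no: "\<And>u. u \<in> V' \<Longrightarrow> u \<noteq> r \<Longrightarrow> anchor (par u) \<noteq> w"
    by (auto simp: C.leaves_T par'_def)
  show "w \<in> V'" by fact
  show "leaf_anchor w"
  proof (rule ccontr)
    assume nc: "\<not> leaf_anchor w"
    \<comment> \<open>A deepest vertex with anchor \<open>w\<close> is no leaf, so its child is on the next start level.\<close>
    let ?D = "{v \<in> V. anchor v = w}"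
    have "w \<in> ?D" using w V'_subset anchor_V' by auto
    then have D: "finite ?D" "?D \<noteq> {}" using finite_V by auto
    have "Max (lev ` ?D) \<in> lev ` ?D" using D by (intro Max_in) auto
    then obtain v where v: "v \<in> V" "anchor v = w" "lev v = Max (lev ` ?D)" by auto
    have max: "lev u \<le> lev v" if "u \<in> V" "anchor u = w" for u
      unfolding v(3) using that D by (intro Max_ge) auto
    have "v \<notin> leaves T r" using nc v(2) by (auto simp: leaf_anchor_def)
    then obtain u where u: "u \<in> V" "u \<noteq> r" "par u = v" using v(1) by (auto simp: leaves_T)
    have "anchor u \<noteq> w" using max[OF u(1)] lev_par[OF u(1,2)] u(3) by auto
    then have st: "start (lev u)" using anchor_par[OF u(1)] u(3) v(2) by auto
    have "live v" using w v(2) live_anchor_iff[OF v(1)] by (simp add: V'_def)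
    then have "u \<in> V'" using u st nc v(2) live_iff[of u] by (simp add: V'_def)
    then show False using no u v(2) by blast
  qed
next
  fix w assume "w \<in> {v \<in> V'. leaf_anchor v}"
  then have w: "w \<in> V'" "leaf_anchor w" by auto
  have "par' u \<noteq> w" if "u \<in> V' - {r}" for u
    using that w(2) live_iff[of u] by (auto simp: V'_def par'_def)
  then show "w \<in> leaves C.T r" using w(1) by (auto simp: C.leaves_T)
qed

text \<open>The uppermost pruned ancestor was cut because the anchor of its parent is a leaf anchor;
  the parent is live, so this anchor belongs to \<open>V'\<close>.\<close>

lemma not_live_leaf_anchor_anc:
  "v \<in> V \<Longrightarrow> \<not> live v \<Longrightarrow> \<exists>z\<in>V'. leaf_anchor z \<and> z \<in> anc r par v"
proof (induction rule: lev_induct)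
  case root
  then show ?case using live_root by simp
next
  case (step v)
  have p: "par v \<in> anc r par v" using anc.anc_par[OF anc.anc_refl step(2)] .
  show ?case
  proof (cases "live (par v)")
    case True
    then have "leaf_anchor (anchor (par v))" using step live_iff[of v] by auto
    then show ?thesis using True anchor_in_V'_iff anchor_in_anc par_in[OF step(1,2)] p anc_trans by metis
  qed (use step p anc_trans in metis)
qed

lemma leaf_leaf_anchor_anc:
  assumes "v \<in> leaves T r" shows "\<exists>z\<in>V'. leaf_anchor z \<and> z \<in> anc r par v"
proof (cases "live v")
  case True
  have "v \<in> V" using assms by (simp add: leaves_T)
  then show ?thesis using True assms anchor_in_V'_iff anchor_in_anc by (auto simp: leaf_anchor_def)
qed (use assms not_live_leaf_anchor_anc in \<open>auto simp: leaves_T\<close>)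

section \<open>Transfer of solutions between the two trees\<close>

lemma sum_pow2: "(\<Sum>i=1..l. 2 ^ i * B) = (2 ^ Suc l - 2) * (B :: nat)"
proof -
  have "(\<Sum>i=1..l. 2 ^ i * B) + 2 * B = 2 ^ Suc l * B"
    by (induction l) (auto simp: algebra_simps)
  then show ?thesis by (simp add: diff_mult_distrib)
qed

text \<open>Anchors in pruned regions are discarded by the intersection with \<open>V'\<close>. No
  leaf loses its protection: the hit found for a leaf anchor \<open>w\<close> is an ancestor of
  \<open>w\<close> in the compressed tree, hence in \<open>V'\<close>.\<close>

lemma compress_solution:
  assumes S: "rmfc_solution T r (\<lambda>_. B) S"
  shows "rmfc_solution C.T r (\<lambda>l. 2 ^ l * B) (anchor ` S \<inter> V')"
  unfolding C.rmfc_solution_T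
proof (intro conjI ballI)
  have SV: "S \<subseteq> V - {r}" and hit: "\<And>v. v \<in> leaves T r \<Longrightarrow> anc r par v \<inter> S \<noteq> {}"
    and budget: "\<And>l. l \<in> {1..depth T r} \<Longrightarrow> card (S \<inter> {v. lev v \<le> l}) \<le> l * B"
    using S by (auto simp: rmfc_solution_T)
  have finS: "finite S" using SV finite_V finite_subset by blast
  show "anchor ` S \<inter> V' \<subseteq> V' - {r}" using SV anchor_eq_root_iff by blast
  show "anc r par' w \<inter> (anchor ` S \<inter> V') \<noteq> {}" if w: "w \<in> leaves C.T r" for w
  proof -
    obtain v where v: "v \<in> leaves T r" "anchor v = w" "w \<in> V'" using w by (auto simp: leaves_C leaf_anchor_def)
    then have vV: "v \<in> V" by (simp add: leaves_T)
    obtain x where x: "x \<in> anc r par v" "x \<in> S" using hit[OF v(1)] by auto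
    then have "anchor x \<in> anc r par' w" using anchor_anc[OF x(1) vV] v(2) by simp
    then show ?thesis using C.anc_in_V[OF v(3)] x(2) by auto
  qed
  fix l assume "l \<in> {1..depth C.T r}"
  \<comment> \<open>\<open>2 ^ Suc l - 2\<close> is the last level whose vertices have anchors of
    compressed level at most \<open>l\<close>. Budgets are constrained only on levels 1 to the
    depth, hence the cap and the separate case \<open>k = 0\<close>.\<close>
  define k where "k = min (2 ^ Suc l - 2) (depth T r)"
  have k: "card (S \<inter> {v. lev v \<le> k}) \<le> k * B"
  proof (cases "k = 0")
    case True
    then have "S \<inter> {v. lev v \<le> k} = {}" using SV lev_eq_0_iff by fastforce
    then show ?thesis by simp
  next
    case False
    then show ?thesis by (intro budget) (auto simp: k_def)
  qed
  have "(anchor ` S \<inter> V') \<inter> {v. lev' v \<le> l} \<subseteq> anchor ` (S \<inter> {v. lev v \<le> k})"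
  proof
    fix y assume "y \<in> (anchor ` S \<inter> V') \<inter> {v. lev' v \<le> l}"
    then obtain x where x: "x \<in> S" "y = anchor x" "anchor x \<in> V'" "lev' (anchor x) \<le> l" by auto
    have xV: "x \<in> V" using x(1) SV by auto
    have "(2::nat) ^ lev' (anchor x) \<le> 2 ^ l" using x(4) by (intro power_increasing) auto
    then have anchor: "lev (anchor x) < 2 ^ l" using Suc_lev[OF x(3)] by linarith
    \<comment> \<open>This is the next start level; had \<open>x\<close> reached it, the anchor
      would not lie above it.\<close>
    have "start (2 ^ Suc l - 1)" unfolding start_def by (intro exI[of _ "Suc l"]) simp
    then have "\<not> 2 ^ Suc l - 1 \<le> lev x" using start_le_lev_anchor[OF xV] anchor by fastforce
    then have "lev x \<le> k" using lev_le_depth[OF xV] by (simp add: k_def)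
    then show "y \<in> anchor ` (S \<inter> {v. lev v \<le> k})" using x by auto
  qed
  then have "card ((anchor ` S \<inter> V') \<inter> {v. lev' v \<le> l}) \<le> card (S \<inter> {v. lev v \<le> k})"
    using finS by (meson card_image_le card_mono finite_Int finite_imageI le_trans)
  also have "\<dots> \<le> k * B" by (rule k)
  also have "\<dots> \<le> (2 ^ Suc l - 2) * B" by (intro mult_right_mono) (auto simp: k_def)
  finally show "card (anchor ` S \<inter> V' \<inter> {v. lev' v \<le> l}) \<le> (\<Sum>i = 1..l. 2 ^ i * B)"
    using sum_pow2[of B l] by simp
qed

text \<open>Every leaf of \<open>G\<close> has a leaf of the compressed tree among its ancestors,
  and ancestors in the compressed tree are ancestors in \<open>G\<close>, so the same set
  covers.\<close>

lemma lift_solution: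
  assumes S: "rmfc_solution C.T r (\<lambda>l. 2 ^ l * B) S"
  shows "rmfc_solution T r (\<lambda>_. 2 * B) S"
  unfolding rmfc_solution_T
proof (intro conjI ballI)
  have SV: "S \<subseteq> V' - {r}" and hit: "\<And>v. v \<in> leaves C.T r \<Longrightarrow> anc r par' v \<inter> S \<noteq> {}"
    and budget: "\<And>l. l \<in> {1..depth C.T r} \<Longrightarrow> card (S \<inter> {v. lev' v \<le> l}) \<le> (2 ^ Suc l - 2) * B"
    using S using sum_pow2[of B] by (auto simp: C.rmfc_solution_T)
  have finS: "finite S" using SV C.finite_V finite_subset by blast
  show "S \<subseteq> V - {r}" using SV V'_subset by auto
  show "anc r par v \<inter> S \<noteq> {}" if v: "v \<in> leaves T r" for v
  proof -
    obtain z where z: "z \<in> V'" "leaf_anchor z" "z \<in> anc r par v" using leaf_leaf_anchor_anc[OF v] by blast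
    obtain x where "x \<in> anc r par' z" "x \<in> S" using hit[of z] z by (auto simp: leaves_C)
    then show ?thesis using anc'_subset[OF z(1)] anc_trans[OF _ z(3)] by blast
  qed
  fix l assume l: "l \<in> {1..depth T r}"
  obtain m where m: "2 ^ m \<le> Suc l" "Suc l < 2 ^ Suc m" using ex_group by blast
  \<comment> \<open>A vertex of \<open>V'\<close> on level at most \<open>l\<close> of
    \<open>G\<close> has compressed level at most \<open>m\<close>, the index of the block of
    \<open>l\<close>.\<close>
  define k where "k = min m (depth C.T r)"
  have k: "card (S \<inter> {v. lev' v \<le> k}) \<le> (2 ^ Suc k - 2) * B"
  proof (cases "k = 0")
    case True
    then have "S \<inter> {v. lev' v \<le> k} = {}" using SV C.lev_eq_0_iff by fastforce
    then show ?thesis by simp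
  next
    case False
    then show ?thesis by (intro budget) (auto simp: k_def)
  qed
  have "S \<inter> {v. lev v \<le> l} \<subseteq> S \<inter> {v. lev' v \<le> k}"
  proof
    fix v assume v: "v \<in> S \<inter> {v. lev v \<le> l}"
    then have vV: "v \<in> V'" using SV by auto
    then have "2 ^ lev' v < (2::nat) ^ Suc m" using Suc_lev[OF vV] v m(2) by simp
    then have "lev' v < Suc m" by (rule power_less_imp_less_exp[rotated]) simp
    then show "v \<in> S \<inter> {v. lev' v \<le> k}" using C.lev_le_depth[OF vV] v by (simp add: k_def)
  qed
  then have "card (S \<inter> {v. lev v \<le> l}) \<le> card (S \<inter> {v. lev' v \<le> k})"
    using finS by (intro card_mono) auto
  also have "\<dots> \<le> (2 ^ Suc k - 2) * B" by (rule k)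
  also have "\<dots> \<le> (2 * l) * B"
  proof -
    have "(2::nat) ^ k \<le> 2 ^ m" by (intro power_increasing) (auto simp: k_def)
    \<comment> \<open>Origin of the factor 2: the cumulative budget \<open>2 * (2 ^ m - 1)\<close>
      is at most twice the first level of the block of \<open>l\<close>.\<close>
    then have "(2::nat) ^ Suc k - 2 \<le> 2 * l" unfolding power_Suc using m(1) by linarith
    then show ?thesis by (rule mult_le_mono1)
  qed
  finally show "card (S \<inter> {v. lev v \<le> l}) \<le> (\<Sum>i = 1..l. 2 * B)" by simp
qed

lemma depth_C: "2 ^ depth C.T r \<le> Suc (depth T r)"
proof -
  have "depth C.T r \<in> lev' ` V'" unfolding C.depth_T
    using C.finite_V C.root_in by (intro Max_in) auto
  then obtain v where v: "v \<in> V'" "depth C.T r = lev' v" by auto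
  then show ?thesis using Suc_lev[OF v(1)] lev_le_depth V'_subset by (metis Suc_le_mono subsetD)
qed

end

section \<open>Closure properties of polynomial time\<close>

lemma poly_nat_mono: "x \<le> y \<Longrightarrow> poly (p :: nat poly) x \<le> poly p y"
  by (induction p) (auto intro!: add_mono mult_mono)

text \<open>Lets time bounds be written as plain arithmetic terms; the closure rules then supply the
  polynomial. They rest on the monotonicity of polynomials with natural coefficients.\<close>

definition poly_bounded :: "(nat \<Rightarrow> nat) \<Rightarrow> bool" where
  "poly_bounded b \<longleftrightarrow> (\<exists>p. \<forall>n. b n \<le> poly p n)"

lemma poly_bounded_id: "poly_bounded (\<lambda>n. n)"
  unfolding poly_bounded_def by (intro exI[of _ "[:0, 1:]"]) simp

lemma poly_bounded_const: "poly_bounded (\<lambda>_. k)"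
  unfolding poly_bounded_def by (intro exI[of _ "[:k:]"]) simp

lemma poly_bounded_add:
  assumes "poly_bounded b" "poly_bounded c" shows "poly_bounded (\<lambda>n. b n + c n)"
proof -
  obtain p q where "\<And>n. b n \<le> poly p n" "\<And>n. c n \<le> poly q n"
    using assms unfolding poly_bounded_def by blast
  then show ?thesis unfolding poly_bounded_def
    by (intro exI[of _ "p + q"]) (auto intro: add_mono)
qed

lemma poly_bounded_mult:
  assumes "poly_bounded b" "poly_bounded c" shows "poly_bounded (\<lambda>n. b n * c n)"
proof -
  obtain p q where "\<And>n. b n \<le> poly p n" "\<And>n. c n \<le> poly q n"
    using assms unfolding poly_bounded_def by blast
  then show ?thesis unfolding poly_bounded_def
    by (intro exI[of _ "p * q"]) (auto intro: mult_mono)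
qed

lemma poly_bounded_poly:
  assumes "poly_bounded b" shows "poly_bounded (\<lambda>n. poly q (b n))"
proof -
  obtain p where "\<And>n. b n \<le> poly p n"
    using assms unfolding poly_bounded_def by blast
  then show ?thesis unfolding poly_bounded_def
    by (intro exI[of _ "pcompose q p"]) (auto simp: poly_pcompose intro: poly_nat_mono)
qed

lemmas poly_bounded_intros =
  poly_bounded_id poly_bounded_const poly_bounded_add poly_bounded_mult poly_bounded_poly

text \<open>The frame condition on the variables from \<open>N\<close> on lets programs be composed without
  renaming; the initial values of all variables but 0 are arbitrary.\<close>

definition ptime_on :: "sexp set \<Rightarrow> (sexp \<Rightarrow> sexp) \<Rightarrow> bool" where
  "ptime_on X f \<longleftrightarrow> (\<exists>c N p. \<forall>s. s 0 \<in> X \<longrightarrow> (\<exists>t s'. exec c s t s' \<and> s' 0 = f (s 0) \<and>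
     (\<forall>i\<ge>N. s' i = s i) \<and> t \<le> poly p (size (s 0))))"

lemma ptime_onI:
  assumes "poly_bounded b"
    and "\<And>s. s 0 \<in> X \<Longrightarrow> \<exists>t s'. exec c s t s' \<and> s' 0 = f (s 0) \<and>
      (\<forall>i\<ge>N. s' i = s i) \<and> t \<le> b (size (s 0))"
  shows "ptime_on X f"
proof -
  obtain p where p: "\<And>n. b n \<le> poly p n" using assms(1) unfolding poly_bounded_def by blast
  show ?thesis unfolding ptime_on_def
    by (rule exI[of _ c], rule exI[of _ N], rule exI[of _ p]) (meson assms(2) p le_trans)
qed

lemma ptime_onE:
  assumes "ptime_on X f"
  obtains c N p where
    "\<And>s. s 0 \<in> X \<Longrightarrow> \<exists>t s'. exec c s t s' \<and> s' 0 = f (s 0) \<and>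
      (\<forall>i\<ge>N. s' i = s i) \<and> t \<le> poly p (size (s 0))"
  using assms unfolding ptime_on_def by metis

lemma size_eval_le_cost: "size (eval_expr e s) \<le> cost e s"
  by (induction e) auto

text \<open>Every stored value has been paid for in its evaluation. This bounds outputs by running
  times, and so the inputs of subsequent programs.\<close>

lemma exec_size: "exec c s t s' \<Longrightarrow> size (s' i) \<le> size (s i) + t"
proof (induction rule: exec.induct)
  case (Assign x e s)
  then show ?case using size_eval_le_cost[of e s] by auto
qed auto

lemma ptime_on_size:
  assumes "ptime_on X f"
  obtains q where "\<And>x. x \<in> X \<Longrightarrow> size (f x) \<le> poly q (size x)"
proof -
  obtain c N p where c: "\<And>s. s 0 \<in> X \<Longrightarrow> \<exists>t s'. exec c s t s' \<and> s' 0 = f (s 0) \<and>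
      (\<forall>i\<ge>N. s' i = s i) \<and> t \<le> poly p (size (s 0))"
    using ptime_onE[OF assms] by blast
  have "size (f x) \<le> poly ([:0, 1:] + p) (size x)" if "x \<in> X" for x
    using c[of "\<lambda>_. x"] that exec_size[of c "\<lambda>_. x" _ _ 0] by fastforce
  then show thesis using that by blast
qed

lemma ptime_on_expr:
  assumes "\<And>s. eval_expr e s = f (s 0)" "poly_bounded b" "\<And>s. cost e s \<le> b (size (s 0))"
  shows "ptime_on X f"
proof (rule ptime_onI)
  show "poly_bounded (\<lambda>n. 1 + b n)" by (intro poly_bounded_intros assms(2))
  show "\<exists>t s'. exec (Assign 0 e) s t s' \<and> s' 0 = f (s 0) \<and> (\<forall>i\<ge>1. s' i = s i) \<and> t \<le> 1 + b (size (s 0))"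
    if "s 0 \<in> X" for s
    using exec.Assign[of 0 e s] assms(1,3)
    by (intro exI[of _ "1 + cost e s"] exI[of _ "s(0 := eval_expr e s)"]) auto
qed

lemma ptime_on_id: "ptime_on X (\<lambda>x. x)"
  by (rule ptime_on_expr[of "Var 0" _ "\<lambda>n. 1 + n"]) (intro poly_bounded_intros | simp)+

lemma ptime_on_Atom: "ptime_on X (\<lambda>_. Atom)"
  by (rule ptime_on_expr[of AtomE _ "\<lambda>_. 1"]) (auto intro!: poly_bounded_intros)

lemma size_car_le: "size (car x) \<le> size x"
  by (cases x) auto

lemma size_cdr_le: "size (cdr x) \<le> size x"
  by (cases x) auto

lemma ptime_on_comp:
  assumes f: "ptime_on X f" and g: "ptime_on Y g" and sub: "\<And>x. x \<in> X \<Longrightarrow> f x \<in> Y"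
  shows "ptime_on X (\<lambda>x. g (f x))"
proof -
  obtain c N p where c: "\<And>s. s 0 \<in> X \<Longrightarrow> \<exists>t s'. exec c s t s' \<and> s' 0 = f (s 0) \<and>
      (\<forall>i\<ge>N. s' i = s i) \<and> t \<le> poly p (size (s 0))"
    using ptime_onE[OF f] by blast
  obtain d M q where d: "\<And>s. s 0 \<in> Y \<Longrightarrow> \<exists>t s'. exec d s t s' \<and> s' 0 = g (s 0) \<and>
      (\<forall>i\<ge>M. s' i = s i) \<and> t \<le> poly q (size (s 0))"
    using ptime_onE[OF g] by blast
  show ?thesis
  proof (rule ptime_onI)
    show "poly_bounded (\<lambda>n. 1 + poly p n + poly q (n + poly p n))"
      by (intro poly_bounded_intros)
    fix s :: state assume s: "s 0 \<in> X"
    obtain t1 s1 where 1: "exec c s t1 s1" "s1 0 = f (s 0)" "\<And>i. i \<ge> N \<Longrightarrow> s1 i = s i"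
      "t1 \<le> poly p (size (s 0))" using c[of s, OF s] by blast
    obtain t2 s2 where 2: "exec d s1 t2 s2" "s2 0 = g (s1 0)" "\<And>i. i \<ge> M \<Longrightarrow> s2 i = s1 i"
      "t2 \<le> poly q (size (s1 0))" using d[of s1] 1(2) sub[OF s] by auto
    have "size (s1 0) \<le> size (s 0) + poly p (size (s 0))"
      using exec_size[OF 1(1), of 0] 1(4) by simp
    then have "t2 \<le> poly q (size (s 0) + poly p (size (s 0)))"
      using 2(4) poly_nat_mono le_trans by blast
    then show "\<exists>t s'. exec (Seq c d) s t s' \<and> s' 0 = g (f (s 0)) \<and> (\<forall>i\<ge>max N M. s' i = s i) \<and>
        t \<le> 1 + poly p (size (s 0)) + poly q (size (s 0) + poly p (size (s 0)))"
      using exec.Seq[OF 1(1) 2(1)] 1 2 by (intro exI[of _ "1 + t1 + t2"] exI[of _ s2]) auto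
  qed
qed

lemma ptime_on_car:
  assumes "ptime_on X f" shows "ptime_on X (\<lambda>x. car (f x))"
proof -
  have "ptime_on UNIV car"
    by (rule ptime_on_expr[of "Car (Var 0)" _ "\<lambda>n. 1 + n + 1 + n"])
      ((intro poly_bounded_intros | simp add: size_car_le)+)
  from ptime_on_comp[OF assms this] show ?thesis by simp
qed

lemma ptime_on_cdr:
  assumes "ptime_on X f" shows "ptime_on X (\<lambda>x. cdr (f x))"
proof -
  have "ptime_on UNIV cdr"
    by (rule ptime_on_expr[of "Cdr (Var 0)" _ "\<lambda>n. 1 + n + 1 + n"])
      ((intro poly_bounded_intros | simp add: size_cdr_le)+)
  from ptime_on_comp[OF assms this] show ?thesis by simp
qed

text \<open>Both programs need the original input. It is saved in \<open>K\<close> and the first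
  result in \<open>Suc K\<close>, variables beyond both frames, which the programs leave
  intact.\<close>

lemma ptime_on_Cell:
  assumes f: "ptime_on X f" and g: "ptime_on X g"
  shows "ptime_on X (\<lambda>x. Cell (f x) (g x))"
proof -
  obtain c N p where c: "\<And>s. s 0 \<in> X \<Longrightarrow> \<exists>t s'. exec c s t s' \<and> s' 0 = f (s 0) \<and>
      (\<forall>i\<ge>N. s' i = s i) \<and> t \<le> poly p (size (s 0))"
    using ptime_onE[OF f] by blast
  obtain d M q where d: "\<And>s. s 0 \<in> X \<Longrightarrow> \<exists>t s'. exec d s t s' \<and> s' 0 = g (s 0) \<and>
      (\<forall>i\<ge>M. s' i = s i) \<and> t \<le> poly q (size (s 0))"
    using ptime_onE[OF g] by blast
  define K where "K = max 1 (max N M)"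
  have K: "K > 0" "K \<ge> N" "K \<ge> M" by (auto simp: K_def)
  define prog where "prog = Seq (Seq (Seq (Assign K (Var 0)) c)
      (Seq (Assign (Suc K) (Var 0)) (Assign 0 (Var K))))
    (Seq d (Assign 0 (Cons (Var (Suc K)) (Var 0))))"
  obtain p' where p': "\<And>x. x \<in> X \<Longrightarrow> size (f x) \<le> poly p' (size x)"
    using ptime_on_size[OF f] by blast
  obtain q' where q': "\<And>x. x \<in> X \<Longrightarrow> size (g x) \<le> poly q' (size x)"
    using ptime_on_size[OF g] by blast
  show ?thesis
  proof (rule ptime_onI)
    show "poly_bounded (\<lambda>n. 20 + 2 * n + 3 * poly p' n + 2 * poly q' n + poly p n + poly q n)"
      by (intro poly_bounded_intros)
    fix s :: state assume s: "s 0 \<in> X"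
    define s1 where "s1 = s(K := s 0)"
    have e1: "exec (Assign K (Var 0)) s (2 + size (s 0)) s1"
      using exec.Assign[of K "Var 0" s] by (simp add: s1_def)
    obtain t2 s2 where 2: "exec c s1 t2 s2" "s2 0 = f (s 0)" "\<And>i. i \<ge> N \<Longrightarrow> s2 i = s1 i"
      "t2 \<le> poly p (size (s 0))" using c[of s1] s K by (auto simp: s1_def)
    define s3 where "s3 = s2(Suc K := f (s 0))"
    have e3: "exec (Assign (Suc K) (Var 0)) s2 (2 + size (f (s 0))) s3"
      using exec.Assign[of "Suc K" "Var 0" s2] 2 by (simp add: s3_def)
    define s4 where "s4 = s3(0 := s 0)"
    have s3K: "s3 K = s 0" using 2(3)[of K] K by (simp add: s3_def s1_def)
    have e4: "exec (Assign 0 (Var K)) s3 (2 + size (s 0)) s4"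
      using exec.Assign[of 0 "Var K" s3] s3K by (simp add: s4_def)
    obtain t5 s5 where 5: "exec d s4 t5 s5" "s5 0 = g (s 0)" "\<And>i. i \<ge> M \<Longrightarrow> s5 i = s4 i"
      "t5 \<le> poly q (size (s 0))" using d[of s4] s by (auto simp: s4_def)
    have s5K: "s5 (Suc K) = f (s 0)" using 5(3)[of "Suc K"] K by (simp add: s4_def s3_def)
    define s6 where "s6 = s5(0 := Cell (f (s 0)) (g (s 0)))"
    have e6: "exec (Assign 0 (Cons (Var (Suc K)) (Var 0))) s5
        (5 + 2 * size (f (s 0)) + 2 * size (g (s 0))) s6"
      using exec.Assign[of 0 "Cons (Var (Suc K)) (Var 0)" s5] s5K 5(2)
      by (simp add: s6_def numeral_eq_Suc algebra_simps)
    have frame: "s6 i = s i" if "i \<ge> Suc (Suc K)" for i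
      using that K 5(3)[of i] 2(3)[of i] by (simp add: s6_def s4_def s3_def s1_def)
    show "\<exists>t s'. exec prog s t s' \<and> s' 0 = Cell (f (s 0)) (g (s 0)) \<and>
        (\<forall>i\<ge>Suc (Suc K). s' i = s i) \<and>
        t \<le> 20 + 2 * size (s 0) + 3 * poly p' (size (s 0)) + 2 * poly q' (size (s 0)) +
          poly p (size (s 0)) + poly q (size (s 0))"
      unfolding prog_def
      apply (intro exI conjI)
         apply (rule exec.Seq[OF exec.Seq[OF exec.Seq[OF e1 2(1)] exec.Seq[OF e3 e4]] exec.Seq[OF 5(1) e6]])
      using frame 2(4) 5(4) p'[OF s] q'[OF s] by (auto simp: s6_def)
  qed
qed

definition bool_sexp :: "bool \<Rightarrow> sexp" where
  "bool_sexp b = (if b then Cell Atom Atom else Atom)"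

lemma bool_sexp_eq_Atom [simp]: "bool_sexp b = Atom \<longleftrightarrow> \<not> b"
  by (simp add: bool_sexp_def)

abbreviation ptest_on :: "sexp set \<Rightarrow> (sexp \<Rightarrow> bool) \<Rightarrow> bool" where
  "ptest_on X P \<equiv> ptime_on X (\<lambda>x. bool_sexp (P x))"

text \<open>The test consumes the input, so its result is first paired with a copy of it; the
  branches then run on the copy.\<close>

lemma ptime_on_if:
  assumes b: "ptest_on X b" and f: "ptime_on X f" and g: "ptime_on X g"
  shows "ptime_on X (\<lambda>x. if b x then f x else g x)"
proof -
  have cond: "ptime_on ((\<lambda>x. Cell (bool_sexp (b x)) x) ` X) (\<lambda>y. if car y \<noteq> Atom then f (cdr y) else g (cdr y))"
  proof -
    obtain c N p where c: "\<And>s. s 0 \<in> X \<Longrightarrow> \<exists>t s'. exec c s t s' \<and> s' 0 = f (s 0) \<and>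
        (\<forall>i\<ge>N. s' i = s i) \<and> t \<le> poly p (size (s 0))"
      using ptime_onE[OF f] by blast
    obtain d M q where d: "\<And>s. s 0 \<in> X \<Longrightarrow> \<exists>t s'. exec d s t s' \<and> s' 0 = g (s 0) \<and>
        (\<forall>i\<ge>M. s' i = s i) \<and> t \<le> poly q (size (s 0))"
      using ptime_onE[OF g] by blast
    define K where "K = max 1 (max N M)"
    have K: "K > 0" "K \<ge> N" "K \<ge> M" by (auto simp: K_def)
    define prog where "prog = Seq (Seq (Assign K (Car (Var 0))) (Assign 0 (Cdr (Var 0)))) (Cond (Var K) c d)"
    show ?thesis
    proof (rule ptime_onI)
      show "poly_bounded (\<lambda>n. 20 + 10 * n + poly p n + poly q n)"
        by (intro poly_bounded_intros)
      fix s :: state assume "s 0 \<in> (\<lambda>x. Cell (bool_sexp (b x)) x) ` X"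
      then obtain x where x: "x \<in> X" "s 0 = Cell (bool_sexp (b x)) x" by auto
      define s2 where "s2 = s(K := bool_sexp (b x), 0 := x)"
      have "exec (Assign K (Car (Var 0))) s (1 + cost (Car (Var 0)) s) (s(K := bool_sexp (b x)))"
        using exec.Assign[of K "Car (Var 0)" s] x(2) by simp
      moreover have "exec (Assign 0 (Cdr (Var 0))) (s(K := bool_sexp (b x)))
          (1 + cost (Cdr (Var 0)) (s(K := bool_sexp (b x)))) s2"
        using exec.Assign[of 0 "Cdr (Var 0)" "s(K := bool_sexp (b x))"] x(2) K by (simp add: s2_def)
      ultimately have "exec (Seq (Assign K (Car (Var 0))) (Assign 0 (Cdr (Var 0)))) s
          (1 + (1 + cost (Car (Var 0)) s) + (1 + cost (Cdr (Var 0)) (s(K := bool_sexp (b x))))) s2"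
        by (rule exec.Seq)
      moreover have "1 + (1 + cost (Car (Var 0)) s) + (1 + cost (Cdr (Var 0)) (s(K := bool_sexp (b x))))
          \<le> 10 + 6 * size (s 0)"
        using K x(2) by simp
      ultimately obtain t2 where t2: "exec (Seq (Assign K (Car (Var 0))) (Assign 0 (Cdr (Var 0)))) s t2 s2"
        "t2 \<le> 10 + 6 * size (s 0)" by blast
      have s2: "s2 0 = x" "s2 K = bool_sexp (b x)" using K by (auto simp: s2_def)
      have le: "poly p (size x) \<le> poly p (size (s 0))" "poly q (size x) \<le> poly q (size (s 0))"
        using x(2) by (auto intro: poly_nat_mono)
      obtain t3 s3 where 3: "exec (Cond (Var K) c d) s2 t3 s3" "s3 0 = (if b x then f x else g x)"
        "\<And>i. i \<ge> K \<Longrightarrow> s3 i = s2 i"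
        "t3 \<le> 2 + size (s 0) + poly p (size (s 0)) + poly q (size (s 0))"
      proof (cases "b x")
        case True
        obtain t s' where "exec c s2 t s'" "s' 0 = f x" "\<And>i. i \<ge> N \<Longrightarrow> s' i = s2 i"
          "t \<le> poly p (size x)" using c[of s2] x s2 by auto
        then show thesis
          using that[OF exec.CondTrue[of "Var K" s2 c t s' d]] True s2 K le x(2) by auto
      next
        case False
        obtain t s' where "exec d s2 t s'" "s' 0 = g x" "\<And>i. i \<ge> M \<Longrightarrow> s' i = s2 i"
          "t \<le> poly q (size x)" using d[of s2] x s2 by auto
        then show thesis
          using that[OF exec.CondFalse[of "Var K" s2 d t s' c]] False s2 K le x(2) by auto
      qed
      have "\<forall>i\<ge>Suc K. s3 i = s i" using 3(3) K by (auto simp: s2_def)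
      then show "\<exists>t s'. exec prog s t s' \<and>
          s' 0 = (if car (s 0) \<noteq> Atom then f (cdr (s 0)) else g (cdr (s 0))) \<and>
          (\<forall>i\<ge>Suc K. s' i = s i) \<and> t \<le> 20 + 10 * size (s 0) + poly p (size (s 0)) + poly q (size (s 0))"
        unfolding prog_def
        apply (intro exI conjI)
           apply (rule exec.Seq[OF t2(1) 3(1)])
        using 3(2,4) t2(2) x(2) by auto
    qed
  qed
  have "ptime_on X (\<lambda>x. if car (Cell (bool_sexp (b x)) x) \<noteq> Atom
      then f (cdr (Cell (bool_sexp (b x)) x)) else g (cdr (Cell (bool_sexp (b x)) x)))"
    by (rule ptime_on_comp[OF ptime_on_Cell[OF b ptime_on_id] cond]) auto
  then show ?thesis by (simp cong: if_cong)
qed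

lemma ptest_on_eq:
  assumes "ptime_on X f" "ptime_on X g" shows "ptest_on X (\<lambda>x. f x = g x)"
proof -
  have "ptime_on UNIV (\<lambda>y. bool_sexp (car y = cdr y))"
  proof (rule ptime_on_expr[of "Equal (Car (Var 0)) (Cdr (Var 0))" _ "\<lambda>n. 20 + 10 * n"])
    show "poly_bounded (\<lambda>n. 20 + 10 * n)" by (intro poly_bounded_intros)
    show "cost (Equal (Car (Var 0)) (Cdr (Var 0))) s \<le> 20 + 10 * size (s 0)" for s
      using size_car_le[of "s 0"] size_cdr_le[of "s 0"] by simp
  qed (simp add: bool_sexp_def)
  from ptime_on_comp[OF ptime_on_Cell[OF assms] this] show ?thesis by simp
qed

lemma ptest_on_conj:
  assumes "ptest_on X P" "ptest_on X Q" shows "ptest_on X (\<lambda>x. P x \<and> Q x)"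
proof -
  have "ptime_on X (\<lambda>x. if P x then bool_sexp (Q x) else Atom)"
    by (intro ptime_on_if assms ptime_on_Atom)
  also have "(\<lambda>x. if P x then bool_sexp (Q x) else Atom) = (\<lambda>x. bool_sexp (P x \<and> Q x))"
    by (auto simp: fun_eq_iff bool_sexp_def)
  finally show ?thesis .
qed

lemma ptest_on_not:
  assumes "ptest_on X P" shows "ptest_on X (\<lambda>x. \<not> P x)"
proof -
  have "ptime_on X (\<lambda>x. if P x then Atom else Cell Atom Atom)"
    by (intro ptime_on_if assms ptime_on_Atom ptime_on_Cell)
  also have "(\<lambda>x. if P x then Atom else Cell Atom Atom) = (\<lambda>x. bool_sexp (\<not> P x))"
    by (auto simp: fun_eq_iff bool_sexp_def)
  finally show ?thesis .
qed

section \<open>Bounded loops: folds over lists\<close>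

fun elems :: "sexp \<Rightarrow> sexp list" where
  "elems Atom = []"
| "elems (Cell x y) = x # elems y"

text \<open>The environment \<open>e\<close> stays fixed during the loop. Passing it explicitly
  makes the step a function of its encoded arguments alone, as programs take all input in variable
  0.\<close>

definition sfold :: "(sexp \<Rightarrow> sexp \<Rightarrow> sexp \<Rightarrow> sexp) \<Rightarrow> sexp \<Rightarrow> sexp \<Rightarrow> sexp \<Rightarrow> sexp" where
  "sfold F e l a = fold (F e) (elems l) a"

lemma length_elems_le: "length (elems l) \<le> size l"
  by (induction l rule: elems.induct) auto

lemma sfold_simps: "sfold F e Atom a = a" "sfold F e (Cell h l) a = sfold F e l (F e h a)"
  by (auto simp: sfold_def)


text \<open>\<open>K\<close> holds the environment, \<open>Suc K\<close> the rest of the list and 0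
  the accumulator. If \<open>b\<close> bounds all of these throughout, the body gets inputs of size
  at most \<open>2 + 3 * b\<close>, and every round costs the same.\<close>

lemma exec_sfold_loop:
  assumes body: "\<And>s. \<exists>t s'. exec c s t s' \<and> s' 0 = F (car (s 0)) (car (cdr (s 0))) (cdr (cdr (s 0))) \<and>
      (\<forall>i\<ge>N. s' i = s i) \<and> t \<le> poly p (size (s 0))"
    and K: "0 < K" "N \<le> K"
    and "s K = e" "s (Suc K) = l" "size e \<le> b" "size l \<le> b"
    and "\<And>n. n \<le> length (elems l) \<Longrightarrow> size (fold (F e) (take n (elems l)) (s 0)) \<le> b"
  shows "\<exists>t s'. exec (While (Var (Suc K))
        (Seq (Seq (Assign 0 (Cons (Var K) (Cons (Car (Var (Suc K))) (Var 0)))) c)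
          (Assign (Suc K) (Cdr (Var (Suc K)))))) s t s' \<and>
      s' 0 = sfold F e l (s 0) \<and> (\<forall>i\<ge>Suc (Suc K). s' i = s i) \<and>
      t \<le> Suc (length (elems l)) * (20 + 20 * b + poly p (2 + 3 * b))"
    (is "\<exists>t s'. exec ?loop s t s' \<and> _")
  using assms(4-)
proof (induction l arbitrary: s)
  case Atom
  have "exec ?loop s (1 + cost (Var (Suc K)) s) s"
    by (rule exec.WhileFalse) (use Atom in simp)
  then show ?case using Atom by (auto simp: sfold_simps intro!: exI[of _ s])
next
  case (Cell h l)
  have a: "size (s 0) \<le> b" using Cell.prems(5)[of 0] by simp
  have sizes: "size e \<le> b" "size h + size l < b" using Cell.prems(3,4) by auto
  let ?x = "Cell e (Cell h (s 0))"
  define s1 where "s1 = s(0 := ?x)"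
  have e1: "exec (Assign 0 (Cons (Var K) (Cons (Car (Var (Suc K))) (Var 0)))) s
      (1 + cost (Cons (Var K) (Cons (Car (Var (Suc K))) (Var 0))) s) s1"
    using exec.Assign[of 0 "Cons (Var K) (Cons (Car (Var (Suc K))) (Var 0))" s] Cell.prems
    by (simp add: s1_def)
  obtain t2 s2 where 2: "exec c s1 t2 s2" "s2 0 = F e h (s 0)" "\<And>i. i \<ge> N \<Longrightarrow> s2 i = s1 i"
    "t2 \<le> poly p (size ?x)"
    using body[of s1] by (auto simp: s1_def)
  have "poly p (size ?x) \<le> poly p (2 + 3 * b)"
    using sizes a by (intro poly_nat_mono) simp
  then have t2: "t2 \<le> poly p (2 + 3 * b)" using 2(4) by simp
  have s2: "s2 K = e" "s2 (Suc K) = Cell h l" using 2(3) K Cell.prems by (auto simp: s1_def)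
  define s3 where "s3 = s2(Suc K := l)"
  have e3: "exec (Assign (Suc K) (Cdr (Var (Suc K)))) s2 (1 + cost (Cdr (Var (Suc K))) s2) s3"
    using exec.Assign[of "Suc K" "Cdr (Var (Suc K))" s2] s2 by (simp add: s3_def)
  have s3: "s3 0 = F e h (s 0)" using 2(2) by (simp add: s3_def)
  have "\<exists>t s'. exec ?loop s3 t s' \<and> s' 0 = sfold F e l (s3 0) \<and> (\<forall>i\<ge>Suc (Suc K). s' i = s3 i) \<and>
      t \<le> Suc (length (elems l)) * (20 + 20 * b + poly p (2 + 3 * b))"
  proof (rule Cell.IH(2))
    show "size (fold (F e) (take n (elems l)) (s3 0)) \<le> b" if "n \<le> length (elems l)" for n
      using Cell.prems(5)[of "Suc n"] that s3 by simp
  qed (use s2 sizes in \<open>auto simp: s3_def\<close>)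
  then obtain t4 s4 where 4: "exec ?loop s3 t4 s4" "s4 0 = sfold F e l (s3 0)"
    "\<And>i. i \<ge> Suc (Suc K) \<Longrightarrow> s4 i = s3 i"
    "t4 \<le> Suc (length (elems l)) * (20 + 20 * b + poly p (2 + 3 * b))"
    by blast
  have "exec ?loop s (1 + cost (Var (Suc K)) s + (1 + (1 +
      (1 + cost (Cons (Var K) (Cons (Car (Var (Suc K))) (Var 0))) s) + t2) +
      (1 + cost (Cdr (Var (Suc K))) s2)) + t4) s4"
    by (rule exec.WhileTrue[OF _ exec.Seq[OF exec.Seq[OF e1 2(1)] e3] 4(1)]) (use Cell.prems in simp)
  moreover have "1 + cost (Var (Suc K)) s + (1 + (1 +
      (1 + cost (Cons (Var K) (Cons (Car (Var (Suc K))) (Var 0))) s) + t2) +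
      (1 + cost (Cdr (Var (Suc K))) s2)) \<le> 20 + 20 * b + poly p (2 + 3 * b)"
    using Cell.prems(1,2) s2 sizes a t2 by simp
  moreover have "s4 0 = sfold F e (Cell h l) (s 0)" using 4(2) s3 by (simp add: sfold_simps)
  moreover have "\<forall>i\<ge>Suc (Suc K). s4 i = s i"
    using 4(3) 2(3) K by (simp add: s3_def s1_def)
  ultimately show ?case using 4(4) by (intro exI conjI) auto
qed

text \<open>The number of rounds is at most the size of the list, but repeated polynomial growth can
  be exponential; hence the hypothesis on all intermediate accumulators.\<close>

lemma ptime_on_sfold:
  assumes F: "ptime_on UNIV (\<lambda>x. F (car x) (car (cdr x)) (cdr (cdr x)))"
    and e: "ptime_on X e" and l: "ptime_on X l" and a: "ptime_on X a"
    and bound: "\<And>x n. x \<in> X \<Longrightarrow> n \<le> length (elems (l x)) \<Longrightarrow>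
      size (fold (F (e x)) (take n (elems (l x))) (a x)) \<le> poly q (size x)"
  shows "ptime_on X (\<lambda>x. sfold F (e x) (l x) (a x))"
proof -
  \<comment> \<open>The component \<open>x\<close> itself is included so that the input of the loop
    is at least as large as \<open>x\<close>, the argument in which the hypothesis is
    polynomial.\<close>
  let ?in = "\<lambda>x. Cell x (Cell (e x) (Cell (l x) (a x)))"
  have "ptime_on (?in ` X) (\<lambda>y. sfold F (car (cdr y)) (car (cdr (cdr y))) (cdr (cdr (cdr y))))"
  proof -
    obtain c N p where c: "\<And>s. \<exists>t s'. exec c s t s' \<and> s' 0 = F (car (s 0)) (car (cdr (s 0))) (cdr (cdr (s 0))) \<and>
        (\<forall>i\<ge>N. s' i = s i) \<and> t \<le> poly p (size (s 0))"
      using ptime_onE[OF F] by (metis UNIV_I)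
    define K where "K = Suc N"
    define loop where "loop = While (Var (Suc K))
        (Seq (Seq (Assign 0 (Cons (Var K) (Cons (Car (Var (Suc K))) (Var 0)))) c)
          (Assign (Suc K) (Cdr (Var (Suc K)))))"
    define prog where "prog = Seq (Seq (Assign K (Car (Cdr (Var 0))))
      (Seq (Assign (Suc K) (Car (Cdr (Cdr (Var 0))))) (Assign 0 (Cdr (Cdr (Cdr (Var 0))))))) loop"
    show ?thesis
    proof (rule ptime_onI)
      show "poly_bounded (\<lambda>n. 30 + 20 * n + (1 + n) * (20 + 20 * (n + poly q n) + poly p (2 + 3 * (n + poly q n))))"
        by (intro poly_bounded_intros)
      fix s :: state assume "s 0 \<in> ?in ` X"
      then obtain x where x: "x \<in> X" "s 0 = ?in x" by auto
      let ?n = "size (s 0)"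
      define s1 where "s1 = s(K := e x)"
      define s2 where "s2 = s1(Suc K := l x)"
      define s3 where "s3 = s2(0 := a x)"
      have K: "K > 0" by (simp add: K_def)
      have e1: "exec (Assign K (Car (Cdr (Var 0)))) s (1 + cost (Car (Cdr (Var 0))) s) s1"
        using exec.Assign[of K "Car (Cdr (Var 0))" s] x by (simp add: s1_def)
      have e2: "exec (Assign (Suc K) (Car (Cdr (Cdr (Var 0))))) s1 (1 + cost (Car (Cdr (Cdr (Var 0)))) s1) s2"
        using exec.Assign[of "Suc K" "Car (Cdr (Cdr (Var 0)))" s1] x K by (simp add: s1_def s2_def)
      have e3: "exec (Assign 0 (Cdr (Cdr (Cdr (Var 0))))) s2 (1 + cost (Cdr (Cdr (Cdr (Var 0)))) s2) s3"
        using exec.Assign[of 0 "Cdr (Cdr (Cdr (Var 0)))" s2] x K by (simp add: s1_def s2_def s3_def)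
      have init: "1 + (1 + cost (Car (Cdr (Var 0))) s) +
          (1 + (1 + cost (Car (Cdr (Cdr (Var 0)))) s1) + (1 + cost (Cdr (Cdr (Cdr (Var 0)))) s2)) \<le> 25 + 20 * ?n"
        using x(2) K by (simp add: s1_def s2_def)
      define b where "b = ?n + poly q ?n"
      have le: "size (e x) \<le> b" "size (l x) \<le> b" "length (elems (l x)) \<le> ?n"
        using x(2) length_elems_le[of "l x"] by (auto simp: b_def)
      have "\<exists>t s'. exec loop s3 t s' \<and> s' 0 = sfold F (e x) (l x) (s3 0) \<and>
        (\<forall>i\<ge>Suc (Suc K). s' i = s3 i) \<and>
        t \<le> Suc (length (elems (l x))) * (20 + 20 * b + poly p (2 + 3 * b))"
        unfolding loop_def
      proof (rule exec_sfold_loop[OF c])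
        fix n assume "n \<le> length (elems (l x))"
        then have "size (fold (F (e x)) (take n (elems (l x))) (a x)) \<le> poly q (size x)"
          using bound x by blast
        also have "\<dots> \<le> poly q ?n" using x(2) by (intro poly_nat_mono) simp
        finally show "size (fold (F (e x)) (take n (elems (l x))) (s3 0)) \<le> b"
          by (simp add: s3_def b_def)
      qed (use le K in \<open>auto simp: s1_def s2_def s3_def K_def\<close>)
      then obtain t4 s4 where 4: "exec loop s3 t4 s4" "s4 0 = sfold F (e x) (l x) (a x)"
        "\<And>i. i \<ge> Suc (Suc K) \<Longrightarrow> s4 i = s3 i"
        "t4 \<le> Suc (length (elems (l x))) * (20 + 20 * b + poly p (2 + 3 * b))"
        by (auto simp: s3_def)
      have "t4 \<le> (1 + ?n) * (20 + 20 * b + poly p (2 + 3 * b))"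
        using 4(4) le(3) by (elim le_trans) (intro mult_le_mono1, simp)
      moreover have "\<forall>i\<ge>Suc (Suc K). s4 i = s i" using 4(3) by (simp add: s1_def s2_def s3_def)
      ultimately show "\<exists>t s'. exec prog s t s' \<and>
          s' 0 = sfold F (car (cdr (s 0))) (car (cdr (cdr (s 0)))) (cdr (cdr (cdr (s 0)))) \<and>
          (\<forall>i\<ge>Suc (Suc K). s' i = s i) \<and>
          t \<le> 30 + 20 * ?n + (1 + ?n) * (20 + 20 * (?n + poly q ?n) + poly p (2 + 3 * (?n + poly q ?n)))"
        unfolding prog_def b_def[symmetric]
        apply (intro exI conjI)
           apply (rule exec.Seq[OF exec.Seq[OF e1 exec.Seq[OF e2 e3]] 4(1)])
        using 4(2) x(2) init by auto
    qed
  qed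
  then have "ptime_on X (\<lambda>x. sfold F (car (cdr (?in x))) (car (cdr (cdr (?in x)))) (cdr (cdr (cdr (?in x)))))"
    by (rule ptime_on_comp[rotated]) (auto intro!: ptime_on_Cell ptime_on_id e l a)
  then show ?thesis by simp
qed

lemma size_elems: "h \<in> set (elems l) \<Longrightarrow> size h \<le> size l"
  by (induction l rule: elems.induct) auto

text \<open>The increment may depend on environment and element but not on the accumulator, so
  repetition adds increments instead of compounding them. Folds inherit the property, which covers
  nested loops.\<close>

definition additive :: "(sexp \<Rightarrow> sexp \<Rightarrow> sexp \<Rightarrow> sexp) \<Rightarrow> bool" where
  "additive F \<longleftrightarrow> (\<exists>q. \<forall>e h a. size (F e h a) \<le> size a + poly q (size e + size h))"

lemma additiveI:
  assumes "poly_bounded b" "\<And>e h a. size (F e h a) \<le> size a + b (size e + size h)"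
  shows "additive F"
proof -
  obtain q where "\<And>n. b n \<le> poly q n" using assms(1) unfolding poly_bounded_def by blast
  then show ?thesis unfolding additive_def using assms(2) by (meson add_left_mono le_trans)
qed

lemma size_fold_additive:
  assumes "\<And>e h a. size (F e h a) \<le> size a + poly q (size e + size h)"
    and "\<forall>h\<in>set hs. size h \<le> m"
  shows "size (fold (F e) hs a) \<le> size a + length hs * poly q (size e + m)"
  using assms(2)
proof (induction hs arbitrary: a)
  case (Cons h hs)
  have "size (F e h a) \<le> size a + poly q (size e + size h)" by (rule assms(1))
  also have "\<dots> \<le> size a + poly q (size e + m)" using Cons.prems by (intro add_left_mono poly_nat_mono) auto
  finally show ?case using Cons.IH[of "F e h a"] Cons.prems by simp
qed simp

lemma additive_sfold: "additive F \<Longrightarrow> additive (sfold F)"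
proof -
  assume "additive F"
  then obtain q where q: "\<And>e h a. size (F e h a) \<le> size a + poly q (size e + size h)"
    unfolding additive_def by blast
  have "size (sfold F e l a) \<le> size a + (size e + size l) * poly q (size e + size l)" for e l a
  proof -
    have "size (sfold F e l a) \<le> size a + length (elems l) * poly q (size e + size l)"
      unfolding sfold_def by (intro size_fold_additive[OF q]) (simp add: size_elems)
    also have "\<dots> \<le> size a + (size e + size l) * poly q (size e + size l)"
      using length_elems_le[of l] by (intro add_left_mono mult_le_mono1) simp
    finally show ?thesis .
  qed
  then show ?thesis by (intro additiveI[of "\<lambda>n. n * poly q n"] poly_bounded_intros) auto
qed

lemma ptime_on_sfold_additive:
  assumes F: "ptime_on UNIV (\<lambda>x. F (car x) (car (cdr x)) (cdr (cdr x)))"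
    and "additive F"
    and e: "ptime_on X e" and l: "ptime_on X l" and a: "ptime_on X a"
  shows "ptime_on X (\<lambda>x. sfold F (e x) (l x) (a x))"
proof -
  obtain q where q: "\<And>e h a. size (F e h a) \<le> size a + poly q (size e + size h)"
    using assms(2) unfolding additive_def by blast
  obtain pe where pe: "\<And>x. x \<in> X \<Longrightarrow> size (e x) \<le> poly pe (size x)" using ptime_on_size[OF e] by blast
  obtain pl where pl: "\<And>x. x \<in> X \<Longrightarrow> size (l x) \<le> poly pl (size x)" using ptime_on_size[OF l] by blast
  obtain pa where pa: "\<And>x. x \<in> X \<Longrightarrow> size (a x) \<le> poly pa (size x)" using ptime_on_size[OF a] by blast
  have "poly_bounded (\<lambda>n. poly pa n + poly pl n * poly q (poly pe n + poly pl n))"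
    by (intro poly_bounded_intros)
  then obtain q' where q': "\<And>n. poly pa n + poly pl n * poly q (poly pe n + poly pl n) \<le> poly q' n"
    unfolding poly_bounded_def by blast
  show ?thesis
  proof (rule ptime_on_sfold[OF F e l a])
    fix x n assume x: "x \<in> X" and n: "n \<le> length (elems (l x))"
    have "size (fold (F (e x)) (take n (elems (l x))) (a x))
        \<le> size (a x) + length (take n (elems (l x))) * poly q (size (e x) + size (l x))"
      by (intro size_fold_additive[OF q]) (meson in_set_takeD size_elems)
    also have "\<dots> \<le> poly pa (size x) + poly pl (size x) * poly q (poly pe (size x) + poly pl (size x))"
      using pa[OF x] pl[OF x] pe[OF x] n length_elems_le[of "l x"]
      by (intro add_mono mult_mono poly_nat_mono) auto
    also have "\<dots> \<le> poly q' (size x)" by (rule q')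
    finally show "size (fold (F (e x)) (take n (elems (l x))) (a x)) \<le> poly q' (size x)" .
  qed
qed

lemma polytime_on_if_ptime_on:
  assumes "ptime_on (enc ` X) f" "\<And>x. x \<in> X \<Longrightarrow> f (enc x) = enc' (g x)"
  shows "polytime_on enc enc' X g"
proof -
  obtain c N p where c: "\<And>s. s 0 \<in> enc ` X \<Longrightarrow> \<exists>t s'. exec c s t s' \<and> s' 0 = f (s 0) \<and>
      (\<forall>i\<ge>N. s' i = s i) \<and> t \<le> poly p (size (s 0))"
    using ptime_onE[OF assms(1)] by blast
  have "\<exists>t s. exec c ((\<lambda>_. Atom)(0 := enc x)) t s \<and> s 0 = enc' (g x) \<and> t \<le> poly p (size (enc x))"
    if "x \<in> X" for x
    using c[of "(\<lambda>_. Atom)(0 := enc x)"] that assms(2)[OF that] by auto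
  then show ?thesis unfolding polytime_on_def by blast
qed

section \<open>Compression by breadth-first search\<close>

text \<open>Each undirected edge is listed in one orientation only, so both ends are compared with
  \<open>v\<close>.\<close>

definition add_child :: "'a \<Rightarrow> 'a \<Rightarrow> 'a \<times> 'a \<Rightarrow> 'a list \<Rightarrow> 'a list" where
  "add_child v p = (\<lambda>(x, y) ws. if x = v \<and> y \<noteq> p then y # ws
     else if y = v \<and> x \<noteq> p then x # ws else ws)"

definition children :: "('a \<times> 'a) list \<Rightarrow> 'a \<Rightarrow> 'a \<Rightarrow> 'a list" where
  "children es v p = fold (add_child v p) es []"

text \<open>The triple of a vertex, its parent and its anchor. The root counts as its own parent here;
  as there are no loops, it then has all its neighbours as children.\<close>

type_synonym 'a entry = "'a \<times> 'a \<times> 'a"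

definition close :: "('a \<times> 'a) list \<Rightarrow> 'a entry list \<Rightarrow> 'a list \<Rightarrow> 'a list" where
  "close es F C = fold (\<lambda>(v, p, a) C. if children es v p = [] then a # C else C) F C"

definition emit :: "bool \<Rightarrow> 'a \<Rightarrow> 'a \<Rightarrow> 'a \<Rightarrow> 'a entry list \<times> ('a \<times> 'a) list \<Rightarrow> 'a entry list \<times> ('a \<times> 'a) list" where
  "emit st v a w = (\<lambda>(F, E). if st then ((w, v, w) # F, (a, w) # E) else ((w, v, a) # F, E))"

definition expand :: "('a \<times> 'a) list \<Rightarrow> bool \<Rightarrow> 'a list \<Rightarrow> 'a entry list \<Rightarrow>
    'a entry list \<times> ('a \<times> 'a) list \<Rightarrow> 'a entry list \<times> ('a \<times> 'a) list" where
  "expand es st C = fold (\<lambda>(v, p, a) acc.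
     if st \<and> a \<in> set C then acc else fold (emit st v a) (children es v p) acc)"

text \<open>The components are the current level, the anchors of the leaves seen so far, the edges of the
  compressed tree, and two counters: \<open>j\<close> further levels lie before the next start level, and \<open>k\<close>
  is twice the number of levels visited since the last one, hence finally the distance between
  the next two start levels.\<close>

type_synonym 'a bfs_state = "'a entry list \<times> 'a list \<times> ('a \<times> 'a) list \<times> nat \<times> nat"

text \<open>\<open>close\<close> comes before \<open>expand\<close> so that leaves on the current
  level already take part in the pruning of the next. The counters find the start levels without
  computing powers of two.\<close>

definition bfs_step :: "('a \<times> 'a) list \<Rightarrow> 'a bfs_state \<Rightarrow> 'a bfs_state" where
  "bfs_step es = (\<lambda>(F, C, E, j, k).
     let C' = close es F C; (F', E') = expand es (j = 0) C' F ([], E)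
     in (F', C', E', if j = 0 then (k - 1, 2) else (j - 1, k + 2)))"

definition bfs_init :: "'a \<Rightarrow> 'a bfs_state" where
  "bfs_init r = ([(r, r, r)], [], [], 0, 2)"

text \<open>The vertex list serves as a clock: there are fewer levels below the root than vertices,
  so the search is complete by its end, and further rounds on an empty frontier add nothing.\<close>

definition compress :: "tree_rep \<Rightarrow> tree_rep" where
  "compress = (\<lambda>(vs, es, r).
     let (F, C, E, j, k) = fold (\<lambda>_. bfs_step es) vs (bfs_init r)
     in (fold (\<lambda>(a, w) ws. w # ws) E [r], E, r))"

lemma set_add_child:
  "set (add_child v p e ws) = set ws \<union> {w. (e = (v, w) \<or> e = (w, v)) \<and> w \<noteq> p}"
  by (cases e) (auto simp: add_child_def)

lemma set_children: "set (children es v p) = {w. ((v, w) \<in> set es \<or> (w, v) \<in> set es) \<and> w \<noteq> p}"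
proof -
  have "set (fold (add_child v p) es ws) =
      set ws \<union> {w. ((v, w) \<in> set es \<or> (w, v) \<in> set es) \<and> w \<noteq> p}" for ws
  proof (induction es arbitrary: ws)
    case (Cons e es)
    show ?case unfolding fold_simps Cons.IH set_add_child by auto
  qed simp
  from this[of "[]"] show ?thesis by (simp add: children_def)
qed

lemma distinct_map_if_comp: "distinct (map (g \<circ> f) xs) \<Longrightarrow> distinct (map f xs)"
  by (induction xs) auto

text \<open>A child collected twice would come from two occurrences of the same unordered edge; the
  induction keeps the edges to collected children out of the remaining list.\<close>

lemma distinct_children:
  assumes "distinct (map (\<lambda>(u, v). {u, v}) es)" shows "distinct (children es v p)"
proof -
  have "distinct (fold (add_child v p) es ws)"
    if "distinct ws" "\<forall>w\<in>set ws. {v, w} \<notin> (\<lambda>(u, v). {u, v}) ` set es" for ws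
    using assms that
  proof (induction es arbitrary: ws)
    case (Cons e es)
    obtain x y where e: "e = (x, y)" by force
    have e_new: "{x, y} \<notin> (\<lambda>(u, v). {u, v}) ` set es" using Cons.prems(1) e by simp
    have old: "{v, w} \<notin> (\<lambda>(u, v). {u, v}) ` set es" "{v, w} \<noteq> {x, y}" if "w \<in> set ws" for w
      using Cons.prems(3) that e by simp_all
    consider z where "add_child v p e ws = z # ws" "{v, z} = {x, y}" | "add_child v p e ws = ws"
    proof (cases "x = v \<and> y \<noteq> p")
      case True
      then show thesis using that(1)[of y] by (simp add: e add_child_def)
    next
      case False
      then show thesis using that(1)[of x] that(2)
        by (cases "y = v \<and> x \<noteq> p") (auto simp: e add_child_def insert_commute)
    qed
    then have new: "distinct (add_child v p e ws) \<and>
      (\<forall>w\<in>set (add_child v p e ws). {v, w} \<notin> (\<lambda>(u, v). {u, v}) ` set es)"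
    proof cases
      case (1 z)
      then have "z \<notin> set ws" using old(2) by blast
      then show ?thesis using 1 e_new old(1) Cons.prems(2) by simp
    next
      case 2
      then show ?thesis using old(1) Cons.prems(2) by simp
    qed
    show ?case using Cons.IH[OF _ conjunct1[OF new] conjunct2[OF new]] Cons.prems(1) by simp
  qed simp
  from this[of "[]"] show ?thesis by (simp add: children_def)
qed

lemma close_eq: "close es F C =
    rev (map (\<lambda>(v, p, a). a) (filter (\<lambda>(v, p, a). children es v p = []) F)) @ C"
  unfolding close_def by (induction F arbitrary: C) auto

lemma set_close: "set (close es F C) = set C \<union> {a. \<exists>v p. (v, p, a) \<in> set F \<and> children es v p = []}"
  unfolding close_eq by force

lemma length_close: "length (close es F C) \<le> length C + length F"
  unfolding close_eq by simp

text \<open>A triple \<open>(a, v, w)\<close> stands for a child \<open>w\<close> of a vertex \<open>v\<close> with anchor \<open>a\<close>.\<close>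

definition successors :: "('a \<times> 'a) list \<Rightarrow> bool \<Rightarrow> 'a list \<Rightarrow> 'a entry list \<Rightarrow> 'a entry list" where
  "successors es st C F = concat (map (\<lambda>(v, p, a). if st \<and> a \<in> set C then []
     else map (\<lambda>w. (a, v, w)) (children es v p)) F)"

lemma fold_emit: "fold (emit st v a) ws (F, E) =
    (rev (map (\<lambda>w. (w, v, if st then w else a)) ws) @ F,
     (if st then rev (map (\<lambda>w. (a, w)) ws) else []) @ E)"
  by (induction ws arbitrary: F E) (auto simp: emit_def)

text \<open>New frontier entries and new edges are images of one list, so contents and distinctness
  of both can be read off from \<open>successors\<close>.\<close>

lemma expand_eq: "expand es st C F (F', E) =
    (rev (map (\<lambda>(a, v, w). (w, v, if st then w else a)) (successors es st C F)) @ F',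
     (if st then rev (map (\<lambda>(a, v, w). (a, w)) (successors es st C F)) else []) @ E)"
proof (induction F arbitrary: F' E)
  case (Cons h F)
  obtain v p a where h: "h = (v, p, a)" by (metis prod_cases3)
  let ?ws = "children es v p"
  show ?case
  proof (cases "st \<and> a \<in> set C")
    case True
    then have "expand es st C (h # F) (F', E) = expand es st C F (F', E)"
      "successors es st C (h # F) = successors es st C F"
      by (simp_all add: expand_def successors_def h)
    then show ?thesis by (simp only: Cons.IH)
  next
    case False
    then have "expand es st C (h # F) (F', E) = expand es st C F (fold (emit st v a) ?ws (F', E))"
      and succ: "successors es st C (h # F) = map (\<lambda>w. (a, v, w)) ?ws @ successors es st C F"
      by (auto simp: expand_def successors_def h)
    then show ?thesis unfolding fold_emit Cons.IH succ by (cases st) (simp_all add: comp_def)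
  qed
qed (simp add: expand_def successors_def)

section \<open>Invariant and correctness of the search\<close>

context parent_tree begin

definition par0 :: "'a \<Rightarrow> 'a" where
  "par0 v = (if v = r then r else par v)"

definition entry :: "'a \<Rightarrow> 'a entry" where
  "entry v = (v, par0 v, anchor v)"

text \<open>The counter equations avoid subtraction: if \<open>l\<close> is in block
  \<open>m\<close>, then \<open>j\<close> levels lie strictly between \<open>l\<close> and the start
  level \<open>2 ^ Suc m - 1\<close>, and \<open>k\<close> is twice the number of levels from
  \<open>2 ^ m - 1\<close> to \<open>l\<close>. \<open>C\<close> may repeat anchors shared by
  several leaves, hence its own length bound; for \<open>F\<close> and \<open>E\<close> distinctness
  provides one.\<close>

definition bfs_inv :: "nat \<Rightarrow> 'a bfs_state \<Rightarrow> bool" where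
  "bfs_inv l = (\<lambda>(F, C, E, j, k).
     set F = entry ` {v. live v \<and> lev v = l} \<and> distinct F \<and>
     set C = anchor ` {v \<in> leaves T r. live v \<and> lev v < l} \<and> length C \<le> l * card V \<and>
     set E = (\<lambda>w. (par' w, w)) ` {w \<in> V' - {r}. lev w \<le> l} \<and> distinct E \<and>
     (\<exists>m. 2 ^ m \<le> Suc l \<and> j + Suc (Suc l) = 2 ^ Suc m \<and> k + 2 ^ Suc m = 2 * l + 4))"

lemma bfs_inv_init: "bfs_inv 0 (bfs_init r)"
proof -
  have "{v. live v \<and> lev v = 0} = {r}"
    using live_in_V lev_eq_0_iff lev_root live_root by auto
  moreover have "{w \<in> V' - {r}. lev w \<le> 0} = {}"
    using V'_subset lev_eq_0_iff by auto
  ultimately show ?thesis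
    unfolding bfs_inv_def bfs_init_def by (auto simp: entry_def par0_def intro!: exI[of _ 0])
qed

context
  fixes es :: "('a \<times> 'a) list"
  assumes es: "set es \<union> (set es)\<inverse> = parcs T"
    and distinct_es: "distinct (map (\<lambda>(u, v). {u, v}) es)"
begin

lemma set_children_par0:
  assumes v: "v \<in> V" shows "set (children es v (par0 v)) = {w \<in> V - {r}. par w = v}"
proof (intro set_eqI)
  fix w
  have "w \<noteq> par0 v" if "w \<in> V" "w \<noteq> r" "par w = v"
    using lev_par[OF that(1,2)] lev_par[OF v] that(2,3) unfolding par0_def by (cases "v = r") auto
  moreover have "(v, w) \<in> parcs T \<longleftrightarrow> (v, w) \<in> set es \<or> (w, v) \<in> set es"
    unfolding es[symmetric] by simp
  moreover have "par0 v = par v" if "v \<noteq> r" using that by (simp add: par0_def)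
  ultimately show "w \<in> set (children es v (par0 v)) \<longleftrightarrow> w \<in> {w \<in> V - {r}. par w = v}"
    unfolding set_children mem_Collect_eq parcs_T Diff_iff singleton_iff by metis
qed

lemma children_Nil_iff: "v \<in> V \<Longrightarrow> children es v (par0 v) = [] \<longleftrightarrow> v \<in> leaves T r"
proof -
  assume v: "v \<in> V"
  have "children es v (par0 v) = [] \<longleftrightarrow> {w \<in> V - {r}. par w = v} = {}"
    unfolding set_children_par0[OF v, symmetric] by simp
  then show ?thesis using v by (auto simp: leaves_T)
qed

text \<open>Why one pass suffices: if the next level is a start level, every vertex with the anchor
  of \<open>u\<close> lies no deeper than \<open>u\<close> and is live like \<open>u\<close>, so all
  leaves that could make this anchor a leaf anchor have been seen.\<close>

lemma leaf_anchor_iff_last: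
  assumes u: "live u" "start (Suc (lev u))"
  shows "leaf_anchor (anchor u) \<longleftrightarrow> anchor u \<in> anchor ` {v \<in> leaves T r. live v \<and> lev v \<le> lev u}"
proof
  assume "leaf_anchor (anchor u)"
  then obtain v where v: "v \<in> leaves T r" "anchor v = anchor u" by (auto simp: leaf_anchor_def)
  have V: "u \<in> V" "v \<in> V" using u live_in_V v by (auto simp: leaves_T)
  have "lev v \<le> lev u"
  proof (rule ccontr)
    assume "\<not> lev v \<le> lev u"
    then have "Suc (lev u) \<le> lev (anchor v)" using start_le_lev_anchor[OF V(2) u(2)] by simp
    then show False using lev_anchor_le[OF V(1)] v(2) by simp
  qed
  moreover have "live v" using live_anchor_iff[OF V(1)] live_anchor_iff[OF V(2)] v(2) u(1) by simp
  ultimately show "anchor u \<in> anchor ` {v \<in> leaves T r. live v \<and> lev v \<le> lev u}"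
    using v by (intro image_eqI[of _ _ v]) auto
qed (auto simp: leaf_anchor_def)

lemma bfs_step_inv:
  assumes "bfs_inv l (F, C, E, j, k)" shows "bfs_inv (Suc l) (bfs_step es (F, C, E, j, k))"
proof -
  from assms have F: "set F = entry ` {v. live v \<and> lev v = l}" "distinct F"
    and C: "set C = anchor ` {v \<in> leaves T r. live v \<and> lev v < l}" "length C \<le> l * card V"
    and E: "set E = (\<lambda>w. (par' w, w)) ` {w \<in> V' - {r}. lev w \<le> l}" "distinct E"
    and "\<exists>m. 2 ^ m \<le> Suc l \<and> j + Suc (Suc l) = 2 ^ Suc m \<and> k + 2 ^ Suc m = 2 * l + 4"
    by (auto simp: bfs_inv_def)
  then obtain m where m: "2 ^ m \<le> Suc l" "j + Suc (Suc l) = 2 ^ Suc m" "k + 2 ^ Suc m = 2 * l + 4"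
    by blast
  \<comment> \<open>\<open>2 ^ m < Suc (Suc l) \<le> 2 ^ Suc m\<close>, so
    \<open>Suc (Suc l)\<close> is a power of 2 only if it equals the upper bound.\<close>
  have j: "j = 0 \<longleftrightarrow> start (Suc l)"
  proof
    assume "j = 0"
    then show "start (Suc l)" unfolding start_def using m(2) by (intro exI[of _ "Suc m"]) simp
  next
    assume "start (Suc l)"
    then obtain i where i: "Suc (Suc l) = 2 ^ i" by (auto simp: start_def)
    have "(2::nat) ^ m < 2 ^ i" using m(1) i by linarith
    then have "m < i" by (rule power_less_imp_less_exp[rotated]) simp
    then have "(2::nat) ^ Suc m \<le> 2 ^ i" by (intro power_increasing) auto
    then show "j = 0" using m(2) i by simp
  qed
  define C' where "C' = close es F C"
  define N where "N = successors es (j = 0) C' F"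
  have lenF: "length F \<le> card V"
  proof -
    have "length F = card (set F)" using F(2) by (simp add: distinct_card)
    also have "\<dots> \<le> card {v. live v \<and> lev v = l}"
      unfolding F(1) by (intro card_image_le finite_subset[OF _ finite_V]) (auto intro: live_in_V)
    also have "\<dots> \<le> card V" by (intro card_mono finite_V) (auto intro: live_in_V)
    finally show ?thesis .
  qed
  have C': "set C' = anchor ` {v \<in> leaves T r. live v \<and> lev v < Suc l}" "length C' \<le> Suc l * card V"
  proof -
    have "{a. \<exists>v p. (v, p, a) \<in> set F \<and> children es v p = []} = anchor ` {v \<in> leaves T r. live v \<and> lev v = l}"
      unfolding F(1) using children_Nil_iff live_in_V by (auto simp: entry_def)
    then show "set C' = anchor ` {v \<in> leaves T r. live v \<and> lev v < Suc l}"
      unfolding C'_def set_close C(1) by (auto simp: less_Suc_eq)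
    show "length C' \<le> Suc l * card V"
      unfolding C'_def using length_close[of es F C] C(2) lenF by simp
  qed
  have N: "set N = (\<lambda>w. (anchor (par w), par w, w)) ` {w. live w \<and> lev w = Suc l}" (is "_ = _ ` ?W")
  proof -
    \<comment> \<open>Liveness of a child expressed by what the search can test: on a start level,
      membership in \<open>C'\<close> stands in for being a leaf anchor.\<close>
    have W: "w \<in> ?W \<longleftrightarrow> w \<in> V - {r} \<and> live (par w) \<and> lev (par w) = l \<and>
        \<not> (j = 0 \<and> anchor (par w) \<in> set C')" for w
    proof (cases "w \<in> V - {r} \<and> live (par w) \<and> lev (par w) = l")
      case True
      then show ?thesis using live_iff[of w] lev_par[of w] leaf_anchor_iff_last[of "par w"] j
        unfolding C'(1) by (auto simp: less_Suc_eq_le)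
    next
      case False
      then show ?thesis using live_iff[of w] lev_par[of w] lev_root by auto
    qed
    have "set N = {(a, v, w). (v, par0 v, a) \<in> set F \<and> \<not> (j = 0 \<and> a \<in> set C') \<and>
        w \<in> set (children es v (par0 v))}"
      unfolding N_def successors_def using F(1) by (auto simp: entry_def split: if_splits)
    also have "\<dots> = {(a, v, w). live v \<and> lev v = l \<and> a = anchor v \<and> \<not> (j = 0 \<and> a \<in> set C') \<and>
        w \<in> V - {r} \<and> par w = v}"
      using F(1) set_children_par0 live_in_V by (auto simp: entry_def)
    also have "\<dots> = (\<lambda>w. (anchor (par w), par w, w)) ` ?W"
      using W by auto
    finally show ?thesis .
  qed
  \<comment> \<open>Child lists are duplicate-free, and those of different vertices are disjoint
    because parents are unique.\<close>
  have distN: "distinct (map (\<lambda>(a, v, w). w) N)"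
  proof -
    let ?g = "\<lambda>(v, p, a). if j = 0 \<and> a \<in> set C' then [] else children es v p"
    have "distinct (concat (map ?g F'))" if "distinct F'" "set F' \<subseteq> entry ` V" for F'
      using that
    proof (induction F')
      case (Cons e F')
      then obtain v where v: "v \<in> V" "e = entry v" by auto
      have "set (?g (entry v)) \<inter> set (?g (entry v')) = {}" if "v' \<in> V" "v' \<noteq> v" for v'
        using that v(1) set_children_par0[of v] set_children_par0[of v'] by (auto simp: entry_def)
      then have "set (?g e) \<inter> set (concat (map ?g F')) = {}"
        using Cons.prems v by fastforce
      moreover have "distinct (?g e)"
        using distinct_children[OF distinct_es] by (auto simp: v(2) entry_def)
      ultimately show ?case using Cons by simp
    qed simp
    moreover have "map (\<lambda>(a, v, w). w) N = concat (map ?g F)"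
      unfolding N_def successors_def map_concat map_map
      by (intro arg_cong[of _ _ concat] map_cong refl) (auto simp: comp_def)
    moreover have "set F \<subseteq> entry ` V" unfolding F(1) using live_in_V by auto
    ultimately show ?thesis using F(2) by simp
  qed
  have step: "bfs_step es (F, C, E, j, k) = (rev (map (\<lambda>(a, v, w). (w, v, if j = 0 then w else a)) N), C',
      (if j = 0 then rev (map (\<lambda>(a, v, w). (a, w)) N) else []) @ E,
      if j = 0 then (k - 1, 2) else (j - 1, k + 2))"
    unfolding bfs_step_def N_def C'_def by (simp add: expand_eq Let_def)
  have entry_W: "(w, par w, if j = 0 then w else anchor (par w)) = entry w" if "live w" "lev w = Suc l" for w
    using that j anchor_start[of w] anchor_par[of w] live_in_V lev_root
    by (auto simp: entry_def par0_def)
  have "set (map (\<lambda>(a, v, w). (w, v, if j = 0 then w else a)) N) = entry ` ?W"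
    unfolding set_map N image_image using entry_W by (intro image_cong) auto
  moreover have "distinct (map (\<lambda>(a, v, w). (w, v, if j = 0 then w else a)) N)"
    by (rule distinct_map_if_comp[of fst]) (use distN in \<open>simp add: comp_def case_prod_unfold\<close>)
  moreover have "set ((if j = 0 then rev (map (\<lambda>(a, v, w). (a, w)) N) else []) @ E) =
      (\<lambda>w. (par' w, w)) ` {w \<in> V' - {r}. lev w \<le> Suc l}"
  proof (cases "j = 0")
    case True
    have "(\<lambda>(a, v, w). (a, w)) ` set N = (\<lambda>w. (par' w, w)) ` ?W"
      unfolding N image_image by (simp add: par'_def)
    moreover have "{w \<in> V' - {r}. lev w \<le> Suc l} = ?W \<union> {w \<in> V' - {r}. lev w \<le> l}"
      using True j lev_root by (auto simp: V'_def)
    ultimately show ?thesis using True by (simp add: E(1) image_Un)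
  next
    case False
    then have "{w \<in> V' - {r}. lev w \<le> Suc l} = {w \<in> V' - {r}. lev w \<le> l}"
      using j by (auto simp: V'_def le_Suc_eq)
    then show ?thesis using False by (simp add: E(1))
  qed
  moreover have "distinct ((if j = 0 then rev (map (\<lambda>(a, v, w). (a, w)) N) else []) @ E)"
  proof -
    have "distinct (map (\<lambda>(a, v, w). (a, w)) N)"
      by (rule distinct_map_if_comp[of snd]) (use distN in \<open>simp add: comp_def case_prod_unfold\<close>)
    moreover have "set (map (\<lambda>(a, v, w). (a, w)) N) \<inter> set E = {}"
      unfolding set_map N E(1) by auto
    ultimately show ?thesis using E(2) by auto
  qed
  moreover obtain j' k' where jk: "(if j = 0 then (k - 1, 2) else (j - 1, k + 2)) = (j', k')"
    by fastforce
  \<comment> \<open>The block index goes up exactly when a start level is entered; there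
    \<open>k\<close> has grown to \<open>2 ^ Suc m\<close>, the distance to the start level after
    it.\<close>
  moreover have "\<exists>m'. 2 ^ m' \<le> Suc (Suc l) \<and> j' + Suc (Suc (Suc l)) = 2 ^ Suc m' \<and>
      k' + 2 ^ Suc m' = 2 * Suc l + 4"
    using m jk by (intro exI[of _ "if j = 0 then Suc m else m"]) (auto split: if_splits)
  ultimately show ?thesis unfolding step jk bfs_inv_def split set_rev distinct_rev
    using C' by (intro conjI) assumption+
qed

lemma bfs_inv_fold: "bfs_inv (length xs) (fold (\<lambda>_. bfs_step es) xs (bfs_init r))"
proof (induction xs rule: rev_induct)
  case (snoc x xs)
  then show ?case using bfs_step_inv by (cases "fold (\<lambda>_. bfs_step es) xs (bfs_init r)") simp
qed (simp add: bfs_inv_init)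

end

text \<open>The ancestors of \<open>v\<close> occupy all levels from 0 to
  \<open>lev v\<close>.\<close>

lemma lev_less_card: "v \<in> V \<Longrightarrow> lev v < card V"
proof -
  assume v: "v \<in> V"
  then have "{..lev v} \<subseteq> lev ` V"
  proof (induction rule: lev_induct)
    case root
    then show ?case using root_in lev_root by (auto simp: image_iff intro!: bexI[of _ r])
  next
    case (step v)
    then have "{..lev v} = insert (lev v) {..lev (par v)}"
      using lev_par[OF step(1,2)] by (auto simp: le_Suc_eq)
    then show ?case using step by simp
  qed
  then have "card {..lev v} \<le> card (lev ` V)" by (rule card_mono[rotated]) (simp add: finite_V)
  also have "\<dots> \<le> card V" by (rule card_image_le[OF finite_V])
  finally show ?thesis by simp
qed

end

lemma fold_Cons_snd: "fold (\<lambda>(a, w) ws. w # ws) E ws = rev (map snd E) @ ws"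
  by (induction E arbitrary: ws) auto

lemma compress_correct:
  assumes tree: "parent_tree (set vs) r par lev"
    and vs: "distinct vs" and es: "distinct (map (\<lambda>(u, v). {u, v}) es)"
    and G: "graph_of (vs, es, r) = tree_graph (set vs) r par"
  shows "graph_of (compress (vs, es, r)) =
      tree_graph (parent_tree.V' (set vs) r par lev) r (parent_tree.par' par lev)"
    and "root_of (compress (vs, es, r)) = r"
    and "valid_tree_rep (compress (vs, es, r))"
proof -
  interpret P: parent_tree "set vs" r par lev by fact
  interpret C: parent_tree P.V' r P.par' P.lev' by (rule P.parent_tree')
  obtain F C E j k where s: "fold (\<lambda>_. bfs_step es) vs (bfs_init r) = (F, C, E, j, k)"
    by (metis prod_cases5)
  have "set es \<union> (set es)\<inverse> = parcs P.T" using G by (metis graph_of.simps pair_pre_digraph.select_convs(2))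
  then have inv: "P.bfs_inv (length vs) (F, C, E, j, k)"
    using P.bfs_inv_fold[OF _ es, of vs] s by simp
  have "{w \<in> P.V' - {r}. lev w \<le> length vs} = P.V' - {r}"
    using P.lev_less_card P.V'_subset vs by (fastforce simp: distinct_card)
  then have E: "set E = (\<lambda>w. (P.par' w, w)) ` (P.V' - {r})" "distinct E"
    using inv by (auto simp: P.bfs_inv_def)
  have c: "compress (vs, es, r) = (rev (map snd E) @ [r], E, r)"
    by (simp add: compress_def s fold_Cons_snd)
  have snd_E: "snd ` set E = P.V' - {r}" unfolding E(1) image_image by simp
  then have verts: "set (rev (map snd E) @ [r]) = P.V'" using C.root_in by auto
  show g: "graph_of (compress (vs, es, r)) = tree_graph P.V' r P.par'"
    unfolding c graph_of.simps tree_graph_def verts E(1) by auto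
  show "root_of (compress (vs, es, r)) = r" by (simp add: c)
  have "inj_on snd (set E)" unfolding E(1) by (auto intro: inj_onI)
  then have "distinct (rev (map snd E) @ [r])" using E(2) snd_E by (auto simp: distinct_map)
  moreover have "inj_on (\<lambda>(u, v). {u, v}) (set E)"
  proof (rule inj_onI)
    fix e e' assume e: "e \<in> set E" "e' \<in> set E" "(\<lambda>(u, v). {u, v}) e = (\<lambda>(u, v). {u, v}) e'"
    then obtain w w' where w: "w \<in> P.V' - {r}" "e = (P.par' w, w)" "w' \<in> P.V' - {r}" "e' = (P.par' w', w')"
      unfolding E(1) by blast
    \<comment> \<open>Equal unordered edges with exchanged ends would make two vertices parents of
      each other, against the levels.\<close>
    then show "e = e'" using e(3) C.lev_par[of w] C.lev_par[of w'] by (auto simp: doubleton_eq_iff)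
  qed
  then have "distinct (map (\<lambda>(u, v). {u, v}) E)" using E(2) by (simp add: distinct_map)
  ultimately show "valid_tree_rep (compress (vs, es, r))"
    using C.rooted_tree_T g unfolding c by simp
qed

section \<open>Polynomial-time compression\<close>

lemma elems_enc_list: "elems (enc_list ea xs) = map ea xs"
  by (induction xs) auto

lemma sfold_enc_list:
  assumes "\<And>x acc. F e (ea x) (eb acc) = eb (f x acc)"
  shows "sfold F e (enc_list ea xs) (eb acc) = eb (fold f xs acc)"
  unfolding sfold_def elems_enc_list
  by (induction xs arbitrary: acc) (auto simp: assms)

lemma enc_nat_inj: "enc_nat m = enc_nat n \<longleftrightarrow> m = n"
proof (induction m arbitrary: n rule: less_induct)
  case (less m)
  have "m = n" if "m > 0" "n > 0" "m div 2 = n div 2" "odd m = odd n"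
    using that by presburger
  then show ?case using less[of "m div 2" "n div 2"]
    by (subst (1 2) enc_nat.simps) (auto split: if_splits)
qed

abbreviation "enc_edge \<equiv> enc_pair enc_nat enc_nat"
abbreviation "enc_entry \<equiv> enc_pair enc_nat enc_edge"

text \<open>In unary, the counters are changed by single uses of \<open>Cell\<close> and
  \<open>cdr\<close>; they stay linear in the level, so this is affordable.\<close>

definition unary :: "nat \<Rightarrow> sexp" where
  "unary n = (Cell Atom ^^ n) Atom"

lemma unary_simps [simp]: "unary 0 = Atom" "unary (Suc n) = Cell Atom (unary n)"
  by (auto simp: unary_def)

lemma unary_eq_Atom [simp]: "unary n = Atom \<longleftrightarrow> n = 0"
  by (cases n) auto

lemma cdr_unary [simp]: "cdr (unary n) = unary (n - 1)"
  by (cases n) auto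

lemma size_unary [simp]: "size (unary n) = n"
  by (induction n) auto

section \<open>The search on encoded data\<close>

definition child_s :: "sexp \<Rightarrow> sexp \<Rightarrow> sexp \<Rightarrow> sexp" where
  "child_s e h a = (if car h = car e \<and> cdr h \<noteq> cdr e then Cell (cdr h) a
     else if cdr h = car e \<and> car h \<noteq> cdr e then Cell (car h) a else a)"

definition children_s :: "sexp \<Rightarrow> sexp \<Rightarrow> sexp \<Rightarrow> sexp" where
  "children_s es v p = sfold child_s (Cell v p) es Atom"

definition close_entry_s :: "sexp \<Rightarrow> sexp \<Rightarrow> sexp \<Rightarrow> sexp" where
  "close_entry_s es h C =
     (if children_s es (car h) (car (cdr h)) = Atom then Cell (cdr (cdr h)) C else C)"

definition member_s :: "sexp \<Rightarrow> sexp \<Rightarrow> sexp" where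
  "member_s x xs = sfold (\<lambda>x h b. if x = h then Cell Atom Atom else b) x xs Atom"

text \<open>The environment is \<open>Cell st (Cell v a)\<close>, so between start levels its
  \<open>cdr\<close> already is the tail of the new entry.\<close>

definition emit_s :: "sexp \<Rightarrow> sexp \<Rightarrow> sexp \<Rightarrow> sexp" where
  "emit_s e w acc =
     (if car e = Atom then Cell (Cell (Cell w (cdr e)) (car acc)) (cdr acc)
      else Cell (Cell (Cell w (Cell (car (cdr e)) w)) (car acc)) (Cell (Cell (cdr (cdr e)) w) (cdr acc)))"

definition expand_entry_s :: "sexp \<Rightarrow> sexp \<Rightarrow> sexp \<Rightarrow> sexp" where
  "expand_entry_s e h acc =
     (if car e \<noteq> Atom \<and> member_s (cdr (cdr h)) (car (cdr e)) \<noteq> Atom then acc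
      else sfold emit_s (Cell (car e) (Cell (car h) (cdr (cdr h))))
        (children_s (cdr (cdr e)) (car h) (car (cdr h))) acc)"

text \<open>A state is laid out as the cells of frontier, closed anchors, edges and the two counters.\<close>

definition close_s :: "sexp \<Rightarrow> sexp \<Rightarrow> sexp" where
  "close_s es s = sfold close_entry_s es (car s) (car (cdr s))"

definition expand_s :: "sexp \<Rightarrow> sexp \<Rightarrow> sexp" where
  "expand_s es s = sfold expand_entry_s
     (Cell (bool_sexp (car (cdr (cdr (cdr s))) = Atom)) (Cell (close_s es s) es))
     (car s) (Cell Atom (car (cdr (cdr s))))"

definition counter_s :: "sexp \<Rightarrow> sexp" where
  "counter_s jk = (if car jk = Atom then Cell (cdr (cdr jk)) (Cell Atom (Cell Atom Atom))
     else Cell (cdr (car jk)) (Cell Atom (Cell Atom (cdr jk))))"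

text \<open>Intermediate results are recomputed wherever they occur, which keeps the definition a
  plain composition of functions and is harmless for a polynomial bound.\<close>

definition bfs_step_s :: "sexp \<Rightarrow> sexp \<Rightarrow> sexp" where
  "bfs_step_s es s = Cell (car (expand_s es s)) (Cell (close_s es s)
     (Cell (cdr (expand_s es s)) (counter_s (cdr (cdr (cdr s))))))"

definition bfs_init_s :: "sexp \<Rightarrow> sexp" where
  "bfs_init_s r = Cell (Cell (Cell r (Cell r r)) Atom) (Cell Atom (Cell Atom (Cell Atom (Cell Atom (Cell Atom Atom)))))"

definition bfs_s :: "sexp \<Rightarrow> sexp" where
  "bfs_s g = sfold (\<lambda>es _ s. bfs_step_s es s) (car (cdr g)) (car g) (bfs_init_s (cdr (cdr g)))"

definition compress_s :: "sexp \<Rightarrow> sexp" where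
  "compress_s g = Cell (sfold (\<lambda>_ h ws. Cell (cdr h) ws) Atom (car (cdr (cdr (bfs_s g)))) (Cell (cdr (cdr g)) Atom))
     (Cell (car (cdr (cdr (bfs_s g)))) (cdr (cdr g)))"

fun enc_state :: "nat bfs_state \<Rightarrow> sexp" where
  "enc_state (F, C, E, j, k) = Cell (enc_list enc_entry F) (Cell (enc_list enc_nat C)
     (Cell (enc_list enc_edge E) (Cell (unary j) (unary k))))"

lemma enc_list_eq_Atom [simp]: "enc_list ea xs = Atom \<longleftrightarrow> xs = []"
  by (cases xs) auto

lemma children_s_enc:
  "children_s (enc_list enc_edge es) (enc_nat v) (enc_nat p) = enc_list enc_nat (children es v p)"
  unfolding children_s_def children_def
  using sfold_enc_list[of child_s "Cell (enc_nat v) (enc_nat p)" enc_edge "enc_list enc_nat"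
      "add_child v p" es "[]"]
  by (auto simp: child_s_def add_child_def enc_nat_inj)

lemma member_s_enc: "member_s (enc_nat x) (enc_list enc_nat xs) = bool_sexp (x \<in> set xs)"
proof -
  have "fold (\<lambda>h b. x = h \<or> b) xs b \<longleftrightarrow> x \<in> set xs \<or> b" for b
    by (induction xs arbitrary: b) auto
  then show ?thesis
    unfolding member_s_def
    using sfold_enc_list[of "\<lambda>x h b. if x = h then Cell Atom Atom else b" "enc_nat x" enc_nat bool_sexp
        "\<lambda>h b. x = h \<or> b" xs False]
    by (auto simp: bool_sexp_def enc_nat_inj)
qed

lemma close_s_enc:
  "close_s (enc_list enc_edge es) (enc_state (F, C, E, j, k)) = enc_list enc_nat (close es F C)"
  unfolding close_s_def close_def
  using sfold_enc_list[of close_entry_s "enc_list enc_edge es" enc_entry "enc_list enc_nat" _ F C]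
  by (auto simp: close_entry_s_def children_s_enc)

abbreviation "enc_frontier \<equiv> enc_pair (enc_list enc_entry) (enc_list enc_edge)"

lemma emit_s_enc:
  "emit_s (Cell (bool_sexp st) (Cell (enc_nat v) (enc_nat a))) (enc_nat w) (enc_frontier acc) =
   enc_frontier (emit st v a w acc)"
  by (cases acc) (auto simp: emit_s_def emit_def)

lemma expand_entry_s_enc:
  "expand_entry_s (Cell (bool_sexp st) (Cell (enc_list enc_nat C) (enc_list enc_edge es))) (enc_entry h) (enc_frontier acc) =
   enc_frontier ((\<lambda>(v, p, a) acc. if st \<and> a \<in> set C then acc else fold (emit st v a) (children es v p) acc) h acc)"
  using sfold_enc_list[of emit_s _ enc_nat enc_frontier, OF emit_s_enc]
  by (cases h) (auto simp: expand_entry_s_def member_s_enc children_s_enc)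

lemma expand_s_enc:
  "expand_s (enc_list enc_edge es) (enc_state (F, C, E, j, k)) =
   enc_frontier (expand es (j = 0) (close es F C) F ([], E))"
  using sfold_enc_list[of expand_entry_s _ enc_entry enc_frontier, OF expand_entry_s_enc,
      of "j = 0" "close es F C" es F "([], E)"]
  unfolding expand_s_def expand_def close_s_enc by simp

lemma bfs_step_s_enc:
  "bfs_step_s (enc_list enc_edge es) (enc_state s) = enc_state (bfs_step es s)"
proof -
  obtain F C E j k where s: "s = (F, C, E, j, k)" by (metis prod_cases5)
  obtain F' E' where e: "expand es (j = 0) (close es F C) F ([], E) = (F', E')" by force
  show ?thesis
    unfolding s bfs_step_s_def expand_s_enc close_s_enc bfs_step_def Let_def split e
    by (auto simp: counter_s_def numeral_2_eq_2)
qed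

lemma bfs_init_s_enc: "bfs_init_s (enc_nat r) = enc_state (bfs_init r)"
  by (simp add: bfs_init_s_def bfs_init_def numeral_2_eq_2)

lemma bfs_s_enc: "bfs_s (enc_tree (vs, es, r)) = enc_state (fold (\<lambda>_. bfs_step es) vs (bfs_init r))"
  unfolding bfs_s_def
  using sfold_enc_list[of "\<lambda>es _ s. bfs_step_s es s" "enc_list enc_edge es" enc_nat enc_state]
  by (simp add: enc_tree_def bfs_init_s_enc bfs_step_s_enc)

lemma compress_s_enc: "compress_s (enc_tree g) = enc_tree (compress g)"
proof -
  obtain vs es r where g: "g = (vs, es, r)" by (metis prod_cases3)
  obtain F C E j k where s: "fold (\<lambda>_. bfs_step es) vs (bfs_init r) = (F, C, E, j, k)"
    by (metis prod_cases5)
  show ?thesis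
    using sfold_enc_list[of "\<lambda>_ h ws. Cell (cdr h) ws" Atom enc_edge "enc_list enc_nat" "\<lambda>(a, w) ws. w # ws" E "[r]"]
    unfolding g compress_s_def bfs_s_enc s
    by (auto simp: enc_tree_def compress_def s)
qed

section \<open>Running time of the search\<close>

lemmas ptime_intros =
  ptime_on_if ptest_on_eq ptest_on_conj ptest_on_not ptime_on_Cell ptime_on_car ptime_on_cdr
  ptime_on_id ptime_on_Atom

lemma size_car_cdr_le: "size (car x) + size (cdr x) \<le> size x"
  by (cases x) auto

lemma additive_child_s: "additive child_s"
proof (rule additiveI)
  show "poly_bounded (\<lambda>n. 1 + n)" by (intro poly_bounded_intros)
  show "size (child_s e h a) \<le> size a + (1 + (size e + size h))" for e h a
    using size_car_le[of h] size_cdr_le[of h] by (simp add: child_s_def)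
qed

lemma ptime_children_s:
  assumes "ptime_on X es" "ptime_on X v" "ptime_on X p"
  shows "ptime_on X (\<lambda>x. children_s (es x) (v x) (p x))"
  unfolding children_s_def
proof (rule ptime_on_sfold_additive)
  show "ptime_on UNIV (\<lambda>x. child_s (car x) (car (cdr x)) (cdr (cdr x)))"
    unfolding child_s_def by (intro ptime_intros)
qed (intro additive_child_s ptime_intros assms)+

lemma size_children_s:
  "\<exists>q. \<forall>es v p. size (children_s es v p) \<le> poly q (1 + size v + size p + size es)"
proof -
  obtain q where q: "\<And>e h a. size (sfold child_s e h a) \<le> size a + poly q (size e + size h)"
    using additive_sfold[OF additive_child_s] unfolding additive_def by blast
  have "size (children_s es v p) \<le> poly q (1 + size v + size p + size es)" for es v p
    using q[of "Cell v p" es Atom] by (simp add: children_s_def)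
  then show ?thesis by blast
qed

lemma ptime_close_s:
  assumes "ptime_on X es" "ptime_on X s"
  shows "ptime_on X (\<lambda>x. close_s (es x) (s x))"
  unfolding close_s_def
proof (rule ptime_on_sfold_additive)
  show "ptime_on UNIV (\<lambda>x. close_entry_s (car x) (car (cdr x)) (cdr (cdr x)))"
    unfolding close_entry_s_def by (intro ptime_intros ptime_children_s)
  show "additive close_entry_s"
  proof (rule additiveI)
    show "poly_bounded (\<lambda>n. 1 + n)" by (intro poly_bounded_intros)
    show "size (close_entry_s e h a) \<le> size a + (1 + (size e + size h))" for e h a
      using size_cdr_le[of h] size_cdr_le[of "cdr h"] by (simp add: close_entry_s_def)
  qed
qed (intro ptime_intros assms)+

lemma ptime_member_s:
  assumes "ptime_on X x" "ptime_on X xs"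
  shows "ptime_on X (\<lambda>y. member_s (x y) (xs y))"
  unfolding member_s_def
proof (rule ptime_on_sfold_additive)
  show "ptime_on UNIV (\<lambda>x. if car x = car (cdr x) then Cell Atom Atom else cdr (cdr x))"
    by (intro ptime_intros)
  show "additive (\<lambda>x h b. if x = h then Cell Atom Atom else b)"
    by (rule additiveI[of "\<lambda>_. 1"]) (intro poly_bounded_intros, simp)
qed (intro ptime_intros assms)+

lemma additive_emit_s: "additive emit_s"
proof (rule additiveI)
  show "poly_bounded (\<lambda>n. 10 + 10 * n)" by (intro poly_bounded_intros)
  show "size (emit_s e w a) \<le> size a + (10 + 10 * (size e + size w))" for e w a
    using size_car_cdr_le[of a] size_car_cdr_le[of e] size_car_cdr_le[of "cdr e"]
    by (simp add: emit_s_def)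
qed

lemma ptime_sfold_emit_s:
  assumes "ptime_on X e" "ptime_on X l" "ptime_on X a"
  shows "ptime_on X (\<lambda>x. sfold emit_s (e x) (l x) (a x))"
proof (rule ptime_on_sfold_additive[OF _ additive_emit_s assms])
  show "ptime_on UNIV (\<lambda>x. emit_s (car x) (car (cdr x)) (cdr (cdr x)))"
    unfolding emit_s_def by (intro ptime_intros)
qed

text \<open>The inner loop runs over a list computed from \<open>e\<close> and \<open>h\<close>
  only. Once its size is polynomial in theirs, the additivity of the inner fold carries
  over.\<close>

lemma additive_expand_entry_s: "additive expand_entry_s"
proof -
  obtain q1 where q1: "\<And>e h a. size (sfold emit_s e h a) \<le> size a + poly q1 (size e + size h)"
    using additive_sfold[OF additive_emit_s] unfolding additive_def by blast
  obtain q2 where q2: "\<And>es v p. size (children_s es v p) \<le> poly q2 (1 + size v + size p + size es)"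
    using size_children_s by blast
  show ?thesis
  proof (rule additiveI)
    show "poly_bounded (\<lambda>n. poly q1 (2 + 2 * n + poly q2 (1 + n)))" by (intro poly_bounded_intros)
    fix e h a :: sexp
    let ?n = "size e + size h"
    let ?ch = "children_s (cdr (cdr e)) (car h) (car (cdr h))"
    let ?env = "Cell (car e) (Cell (car h) (cdr (cdr h)))"
    note sizes = size_car_cdr_le[of e] size_car_cdr_le[of "cdr e"] size_car_cdr_le[of h] size_car_cdr_le[of "cdr h"]
    have "1 + size (car h) + size (car (cdr h)) + size (cdr (cdr e)) \<le> 1 + ?n"
      using sizes by linarith
    then have "size ?ch \<le> poly q2 (1 + ?n)" using q2 poly_nat_mono le_trans by blast
    then have "size ?env + size ?ch \<le> 2 + 2 * ?n + poly q2 (1 + ?n)"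
      using sizes by simp
    then have "size a + poly q1 (size ?env + size ?ch) \<le> size a + poly q1 (2 + 2 * ?n + poly q2 (1 + ?n))"
      by (intro add_left_mono poly_nat_mono)
    then have "size (sfold emit_s ?env ?ch a) \<le> size a + poly q1 (2 + 2 * ?n + poly q2 (1 + ?n))"
      using q1[of ?env ?ch a] by linarith
    then show "size (expand_entry_s e h a) \<le> size a + poly q1 (2 + 2 * ?n + poly q2 (1 + ?n))"
      by (simp add: expand_entry_s_def)
  qed
qed

lemma ptime_expand_s:
  assumes "ptime_on X es" "ptime_on X s"
  shows "ptime_on X (\<lambda>x. expand_s (es x) (s x))"
  unfolding expand_s_def
proof (rule ptime_on_sfold_additive)
  show "ptime_on UNIV (\<lambda>x. expand_entry_s (car x) (car (cdr x)) (cdr (cdr x)))"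
    unfolding expand_entry_s_def
    by (intro ptime_intros ptime_children_s ptime_member_s ptime_sfold_emit_s)
qed (intro additive_expand_entry_s ptime_intros ptime_close_s assms)+

lemma ptime_bfs_step_s:
  assumes "ptime_on X es" "ptime_on X s"
  shows "ptime_on X (\<lambda>x. bfs_step_s (es x) (s x))"
  unfolding bfs_step_s_def counter_s_def
  by (intro ptime_intros ptime_close_s ptime_expand_s assms)

lemma size_enc_list:
  assumes "\<forall>x\<in>set xs. size (ea x) \<le> m" "length xs \<le> k"
  shows "size (enc_list ea xs) \<le> k * (1 + m)"
proof -
  have "size (enc_list ea xs) \<le> length xs * (1 + m)"
    using assms(1) by (induction xs) auto
  also have "\<dots> \<le> k * (1 + m)" using assms(2) by (rule mult_le_mono1)
  finally show ?thesis .
qed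

lemma size_enc_list_ge: "x \<in> set xs \<Longrightarrow> size (ea x) \<le> size (enc_list ea xs)"
  by (induction xs) auto

lemma length_le_size_enc_list: "length xs \<le> size (enc_list ea xs)"
  by (induction xs) auto

lemma (in parent_tree) length_le_card: "distinct xs \<Longrightarrow> set xs \<subseteq> f ` V \<Longrightarrow> length xs \<le> card V"
  using card_mono[of "f ` V" "set xs"] card_image_le[OF finite_V, of f] finite_V
  by (simp add: distinct_card)

text \<open>A search step also uses its accumulator as the list to loop over, so additivity is out
  of reach; the invariant bounds each component instead. The summands stand for the four joining
  cells, frontier, closed anchors, edges and counters.\<close>

lemma size_bfs_state:
  assumes "parent_tree V r par lev" "parent_tree.bfs_inv V r par lev l s"
    and "\<And>v. v \<in> V \<Longrightarrow> size (enc_nat v) \<le> n" "l \<le> n" "card V \<le> n"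
  shows "size (enc_state s) \<le> 4 + n * (3 + 3 * n) + n * n * (1 + n) + n * (2 + 2 * n) + (4 * n + 6)"
proof -
  interpret parent_tree V r par lev by fact
  obtain F C E j k where s: "s = (F, C, E, j, k)" by (metis prod_cases5)
  from assms(2) have F: "set F = entry ` {v. live v \<and> lev v = l}" "distinct F"
    and C: "set C = anchor ` {v \<in> leaves T r. live v \<and> lev v < l}" "length C \<le> l * card V"
    and E: "set E = (\<lambda>w. (par' w, w)) ` {w \<in> V' - {r}. lev w \<le> l}" "distinct E"
    and "\<exists>m. 2 ^ m \<le> Suc l \<and> j + Suc (Suc l) = 2 ^ Suc m \<and> k + 2 ^ Suc m = 2 * l + 4"
    by (auto simp: s bfs_inv_def)
  then have jk: "j + k \<le> 4 * n + 6" using assms(4) by auto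
  have verts: "size (enc_nat (anchor v)) \<le> n" "size (enc_nat (par0 v)) \<le> n" "size (enc_nat v) \<le> n"
    if "v \<in> V" for v
    using that assms(3) anchor_in_V par_in by (auto simp: par0_def)
  have "set F \<subseteq> entry ` V" unfolding F(1) using live_in_V by auto
  then have "length F \<le> n" using length_le_card[OF F(2)] assms(5) by (meson le_trans)
  then have "size (enc_list enc_entry F) \<le> n * (1 + (2 + 3 * n))"
  proof (rule size_enc_list[rotated], intro ballI)
    fix x assume "x \<in> set F"
    then obtain v where "x = entry v" "v \<in> V" unfolding F(1) using live_in_V by auto
    then show "size (enc_entry x) \<le> 2 + 3 * n" using verts[of v] by (simp add: entry_def)
  qed
  then have sF: "size (enc_list enc_entry F) \<le> n * (3 + 3 * n)" by (simp add: algebra_simps)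
  have "l * card V \<le> n * n" using assms(4,5) by (intro mult_le_mono)
  then have "length C \<le> n * n" using C(2) by simp
  then have sC: "size (enc_list enc_nat C) \<le> n * n * (1 + n)"
    by (rule size_enc_list[rotated]) (use verts live_in_V in \<open>auto simp: C(1)\<close>)
  have EV: "set E \<subseteq> (\<lambda>w. (par' w, w)) ` (V - {r})" unfolding E(1) using V'_subset by auto
  then have "set E \<subseteq> (\<lambda>w. (par' w, w)) ` V" by auto
  then have "length E \<le> n" using length_le_card[OF E(2)] assms(5) by (meson le_trans)
  then have "size (enc_list enc_edge E) \<le> n * (1 + (1 + 2 * n))"
  proof (rule size_enc_list[rotated], intro ballI)
    fix x assume "x \<in> set E"
    then obtain w where "x = (par' w, w)" "w \<in> V" "w \<noteq> r" using EV by auto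
    then show "size (enc_edge x) \<le> 1 + 2 * n"
      using verts(1)[of "par w"] verts(3)[of w] par_in[of w] by (simp add: par'_def)
  qed
  then have sE: "size (enc_list enc_edge E) \<le> n * (2 + 2 * n)" by (simp add: algebra_simps)
  show ?thesis using sF sC sE jk by (simp add: s)
qed

lemma valid_tree_rep_parent_tree:
  assumes "valid_tree_rep (vs, es, r)"
  obtains par lev where "parent_tree (set vs) r par lev"
    and "graph_of (vs, es, r) = tree_graph (set vs) r par"
  using rooted_tree_parent_tree[of "graph_of (vs, es, r)" r] assms by auto

text \<open>The intermediate states are bounded through the invariant of the search, which holds for
  genuine trees; hence the restriction to encodings of valid ones.\<close>

lemma ptime_bfs_s: "ptime_on (enc_tree ` {g. valid_tree_rep g}) bfs_s"
proof -
  have "poly_bounded (\<lambda>n. 4 + n * (3 + 3 * n) + n * n * (1 + n) + n * (2 + 2 * n) + (4 * n + 6))"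
    by (intro poly_bounded_intros)
  then obtain q where q: "\<And>n :: nat. 4 + n * (3 + 3 * n) + n * n * (1 + n) + n * (2 + 2 * n) + (4 * n + 6) \<le> poly q n"
    unfolding poly_bounded_def by blast
  show ?thesis
    unfolding bfs_s_def bfs_init_s_def
  proof (rule ptime_on_sfold)
    show "ptime_on UNIV (\<lambda>x. bfs_step_s (car x) (cdr (cdr x)))"
      by (intro ptime_bfs_step_s ptime_intros)
    fix x i assume "x \<in> enc_tree ` {g. valid_tree_rep g}" "i \<le> length (elems (car x))"
    then obtain vs es r where x: "x = enc_tree (vs, es, r)" "valid_tree_rep (vs, es, r)" "i \<le> length vs"
      by (auto simp: enc_tree_def elems_enc_list)
    obtain par lev where tree: "parent_tree (set vs) r par lev"
      and G: "graph_of (vs, es, r) = tree_graph (set vs) r par"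
      using valid_tree_rep_parent_tree[OF x(2)] .
    interpret P: parent_tree "set vs" r par lev by (rule tree)
    have "set es \<union> (set es)\<inverse> = parcs P.T"
      using G by (metis graph_of.simps pair_pre_digraph.select_convs(2))
    moreover have "distinct (map (\<lambda>(u, v). {u, v}) es)" using x(2) by simp
    moreover have i: "length (take i vs) = i" using x(3) by simp
    ultimately have inv: "P.bfs_inv i (fold (\<lambda>_. bfs_step es) (take i vs) (bfs_init r))"
      using P.bfs_inv_fold[of es "take i vs"] by (simp only: i)
    have n: "size (enc_list enc_nat vs) \<le> size x" by (simp add: x(1) enc_tree_def)
    then have "length vs \<le> size x" using length_le_size_enc_list[of vs enc_nat] by linarith
    moreover have "size (enc_nat v) \<le> size x" if "v \<in> set vs" for v
      using size_enc_list_ge[OF that, of enc_nat] n by linarith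
    ultimately have "size (enc_state (fold (\<lambda>_. bfs_step es) (take i vs) (bfs_init r))) \<le> poly q (size x)"
      using size_bfs_state[OF tree inv, of "size x"] q[of "size x"] x(3) card_length[of vs] by simp
    \<comment> \<open>Every intermediate value of the encoded loop is the encoding of a search
      state, so the size bound applies to it.\<close>
    moreover have "fold (\<lambda>_. bfs_step_s (enc_list enc_edge es)) (take i (map enc_nat vs)) (bfs_init_s (enc_nat r)) =
        enc_state (fold (\<lambda>_. bfs_step es) (take i vs) (bfs_init r))"
      using sfold_enc_list[of "\<lambda>es _ s. bfs_step_s es s" "enc_list enc_edge es" enc_nat enc_state
          "\<lambda>_. bfs_step es" "take i vs" "bfs_init r"]
      by (simp add: bfs_step_s_enc bfs_init_s_enc sfold_def elems_enc_list take_map)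
    ultimately show "size (fold (\<lambda>_. bfs_step_s (car (cdr x))) (take i (elems (car x)))
        (Cell (Cell (Cell (cdr (cdr x)) (Cell (cdr (cdr x)) (cdr (cdr x)))) Atom)
          (Cell Atom (Cell Atom (Cell Atom (Cell Atom (Cell Atom Atom))))))) \<le> poly q (size x)"
      by (simp add: x(1) enc_tree_def elems_enc_list bfs_init_s_def)
  qed (intro ptime_intros)+
qed

lemma polytime_on_compress: "polytime_on enc_tree enc_tree {g. valid_tree_rep g} compress"
proof (rule polytime_on_if_ptime_on)
  show "compress_s (enc_tree g) = enc_tree (compress g)" for g by (rule compress_s_enc)
  show "ptime_on (enc_tree ` {g. valid_tree_rep g}) compress_s"
    unfolding compress_s_def
  proof (intro ptime_on_Cell)
    show "ptime_on (enc_tree ` {g. valid_tree_rep g}) (\<lambda>g. sfold (\<lambda>_ h. Cell (cdr h)) Atom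
        (car (cdr (cdr (bfs_s g)))) (Cell (cdr (cdr g)) Atom))"
    proof (rule ptime_on_sfold_additive)
      show "ptime_on UNIV (\<lambda>x. Cell (cdr (car (cdr x))) (cdr (cdr x)))" by (intro ptime_intros)
      show "additive (\<lambda>_ h. Cell (cdr h))"
      proof (rule additiveI)
        show "poly_bounded (\<lambda>n. 1 + n)" by (intro poly_bounded_intros)
        show "size (Cell (cdr h) a) \<le> size a + (1 + (size e + size h))" for e h a :: sexp
          using size_cdr_le[of h] by simp
      qed
    qed (intro ptime_intros ptime_bfs_s)+
  qed (intro ptime_intros ptime_bfs_s)+
qed

lemma log_bigo_ln: "(\<lambda>L::nat. log 2 (real (Suc L))) \<in> O(\<lambda>L. ln (real L))"
  unfolding log_def by real_asymp

theorem theorem5: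
  shows "\<exists>(compress :: tree_rep \<Rightarrow> tree_rep)
          (lift :: tree_rep \<times> nat \<times> nat list \<Rightarrow> nat list)
          (h :: nat \<Rightarrow> real).
     polytime_on enc_tree enc_tree {g. valid_tree_rep g} compress \<and>
     polytime_on (enc_pair enc_tree (enc_pair enc_nat (enc_list enc_nat))) (enc_list enc_nat)
       {(g, B, S'). valid_tree_rep g \<and> B > 0 \<and> distinct S' \<and>
          rmfc_solution (graph_of (compress g)) (root_of (compress g)) (\<lambda>l. 2 ^ l * B) (set S')}
       lift \<and>
     h \<in> O(\<lambda>L. ln (real L)) \<and>
     (\<forall>g. valid_tree_rep g \<longrightarrow>
       (let G = graph_of g; r = root_of g;
            G' = graph_of (compress g); r' = root_of (compress g)
        in valid_tree_rep (compress g) \<and>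
           card (pverts G') \<le> card (pverts G) \<and>
           real (depth G' r') \<le> h (depth G r) \<and>
           (\<forall>B::nat. B > 0 \<longrightarrow>
              (\<exists>S. rmfc_solution G r (\<lambda>l. B) S) \<longrightarrow>
              (\<exists>S'. rmfc_solution G' r' (\<lambda>l. 2 ^ l * B) S')) \<and>
           (\<forall>(B::nat) S'. B > 0 \<longrightarrow> distinct S' \<longrightarrow>
              rmfc_solution G' r' (\<lambda>l. 2 ^ l * B) (set S') \<longrightarrow>
              distinct (lift (g, B, S')) \<and>
              rmfc_solution G r (\<lambda>l. 2 * B) (set (lift (g, B, S'))))))"
\<comment> \<open>Lifting is a projection, as solutions carry over unchanged. The bound
  \<open>log 2 (real (Suc L))\<close> comes from \<open>2 ^ L' \<le> Suc L\<close> for the depth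
  \<open>L'\<close> of the compressed tree; it also covers \<open>L = 0\<close>, with value
  0.\<close>
proof (intro exI[of _ compress] exI[of _ "\<lambda>(g, B, S'). S'"] exI[of _ "\<lambda>L. log 2 (real (Suc L))"]
    conjI allI impI polytime_on_compress log_bigo_ln)
  show "polytime_on (enc_pair enc_tree (enc_pair enc_nat (enc_list enc_nat))) (enc_list enc_nat)
       {(g, B, S'). valid_tree_rep g \<and> B > 0 \<and> distinct S' \<and>
          rmfc_solution (graph_of (compress g)) (root_of (compress g)) (\<lambda>l. 2 ^ l * B) (set S')}
       (\<lambda>(g, B, S'). S')"
    by (rule polytime_on_if_ptime_on[of _ _ "\<lambda>x. cdr (cdr x)"]) (intro ptime_intros, auto)
  fix g assume valid: "valid_tree_rep g"
  obtain vs es r where g: "g = (vs, es, r)" by (metis prod_cases3)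
  obtain par lev where tree: "parent_tree (set vs) r par lev"
    and G: "graph_of g = tree_graph (set vs) r par"
    using valid_tree_rep_parent_tree valid unfolding g by blast
  interpret P: parent_tree "set vs" r par lev by (rule tree)
  interpret C: parent_tree P.V' r P.par' P.lev' by (rule P.parent_tree')
  have "distinct vs" "distinct (map (\<lambda>(u, v). {u, v}) es)" using valid by (simp_all add: g)
  note c = compress_correct[OF tree this G[unfolded g], folded g]
  have roots: "root_of g = r" by (simp add: g)
  have card: "card P.V' \<le> card (set vs)" using P.V'_subset by (intro card_mono) auto
  have depth: "real (depth (tree_graph P.V' r P.par') r) \<le> log 2 (real (Suc (depth P.T r)))"
    using P.depth_C by (rule le_log2_of_power)
  show "let G = graph_of g; r = root_of g; G' = graph_of (compress g); r' = root_of (compress g)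
        in valid_tree_rep (compress g) \<and>
           card (pverts G') \<le> card (pverts G) \<and>
           real (depth G' r') \<le> log 2 (real (Suc (depth G r))) \<and>
           (\<forall>B::nat. B > 0 \<longrightarrow>
              (\<exists>S. rmfc_solution G r (\<lambda>l. B) S) \<longrightarrow>
              (\<exists>S'. rmfc_solution G' r' (\<lambda>l. 2 ^ l * B) S')) \<and>
           (\<forall>(B::nat) S'. B > 0 \<longrightarrow> distinct S' \<longrightarrow>
              rmfc_solution G' r' (\<lambda>l. 2 ^ l * B) (set S') \<longrightarrow>
              distinct (case (g, B, S') of (g, B, S') \<Rightarrow> S') \<and>
              rmfc_solution G r (\<lambda>l. 2 * B) (set (case (g, B, S') of (g, B, S') \<Rightarrow> S')))"
    unfolding Let_def c(1,2) roots G split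
    using c(3) card depth P.compress_solution P.lift_solution
    by auto
qed

end
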